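(* Let $T>0$, $d\ge1$, and let $b:[0,T]\times\mathbb{R}^d\times\mathcal{P}(\mathbb{R}^d)\to\mathbb{R}^d$ and $a:[0,T]\times\mathbb{R}^d\times\mathcal{P}(\mathbb{R}^d)\to\mathrm{Sym}_+(\mathbb{R}^{d\times d})$ be Borel measurable functions. Then the subset $\mathrm{KFP}(b,a)\subset C([0,T],\mathcal{P}(\mathbb{R}^d))$ is Borel.
   Context: $\mathcal{P}(\mathbb{R}^d)$: Borel probability measures on $\mathbb{R}^d$ with the narrow topology (Polish); $C([0,T],\mathcal{P}(\mathbb{R}^d))$ has the compact-open topology (Polish). $\mathrm{Sym}_+(\mathbb{R}^{d\times d})$: symmetric positive semidefinite matrices; $A:B=\sum_{i,j}A_{ij}B_{ij}$; $b_t(x,\mu)=b(t,x,\mu)$, $a_t(x,\mu)=a(t,x,\mu)$. For $\phi\in C_b^2(\mathbb{R}^d)$ and $\boldsymbol{\mu}=(\mu_t)\in C([0,T],\mathcal{P}(\mathbb{R}^d))$: $L^{\boldsymbol{\mu}}_{b_t,a_t}\phi(x)=\frac12a_t(x,\mu_t):\nabla^2\phi(x)+b_t(x,\mu_t)\cdot\nabla\phi(x)$. $\mathrm{KFP}(b,a)$ is the set of $\boldsymbol{\mu}\in C([0,T],\mathcal{P}(\mathbb{R}^d))$ such that $\int_0^T\int_{\mathbb{R}^d}\frac{|b_t(x,\mu_t)|}{1+|x|}+\frac{|a_t(x,\mu_t)|}{1+|x|^2}d\mu_t(x)dt<\infty$ and $\partial_t\mu_t=(L^{\boldsymbol{\mu}}_{b_t,a_t})^*\mu_t$,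 i.e. for all $\xi\in C_c^1((0,T))$, $\phi\in C_c^2(\mathbb{R}^d)$: $\int_0^T\xi'(t)\int\phi\,d\mu_tdt=-\int_0^T\xi(t)\int L^{\boldsymbol{\mu}}_{b_t,a_t}\phi\,d\mu_tdt$. *)

theory Defs
  imports "HOL-Probability.Probability"
begin

text \<open>Borel probability measures with the narrow topology. They are set up as a type, so that
  \<^term>\<open>borel\<close>, \<^term>\<open>continuous_on\<close> and product topologies are those of the library.\<close>

typedef (overloaded) 'a prob_measure =
  "{M :: 'a::topological_space measure. prob_space M \<and> sets M = sets borel}"
  morphisms the_measure Abs_prob_measure
proof
  show "return borel undefined \<in> {M :: 'a measure. prob_space M \<and> sets M = sets borel}"
    by (simp add: prob_space_return)
qed

instantiation prob_measure :: (topological_space) topological_space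
begin

text \<open>The coarsest topology for which all maps \<open>\<mu> \<mapsto> \<integral>f d\<mu>\<close> with \<open>f\<close> bounded and continuous are
  continuous.\<close>

definition open_prob_measure :: "'a prob_measure set \<Rightarrow> bool" where
  "open_prob_measure = generate_topology
     {{\<mu>. (\<integral>x. f x \<partial>the_measure \<mu>) \<in> U} |(f :: 'a \<Rightarrow> real) U.
        continuous_on UNIV f \<and> bounded (range f) \<and> open U}"

instance
  by standard (auto simp: open_prob_measure_def intro: generate_topology.intros)

end

text \<open>The space \<open>C([0,T], X)\<close>. Functions on \<open>[0,T]\<close> are represented by their extensional
  representatives on the whole real line (equal to \<^term>\<open>undefined\<close> outside of \<open>[0,T]\<close>), so that
  equality is equality on \<open>[0,T]\<close>.\<close>

definition cont_paths :: "real \<Rightarrow> (real \<Rightarrow> 'a::topological_space) set" where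
  "cont_paths T = {\<gamma> \<in> extensional {0..T}. continuous_on {0..T} \<gamma>}"

definition compact_open_topology :: "real \<Rightarrow> (real \<Rightarrow> 'a::topological_space) topology" where
  "compact_open_topology T = topology_generated_by
     {{\<gamma> \<in> cont_paths T. \<gamma> ` K \<subseteq> U} |K U. compact K \<and> K \<subseteq> {0..T} \<and> open U}"

lemma topspace_compact_open_topology [simp]:
  "topspace (compact_open_topology T) = cont_paths T"
proof -
  have "cont_paths T \<in> {{\<gamma> \<in> cont_paths T. \<gamma> ` K \<subseteq> U} |K U.
      compact K \<and> K \<subseteq> {0..T} \<and> open (U :: 'a set)}"
    by (rule CollectI, rule exI[of _ "{}"], rule exI[of _ UNIV]) auto
  then show ?thesis
    unfolding compact_open_topology_def topology_generated_by_topspace by blast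
qed

definition borel_sets_of :: "'a topology \<Rightarrow> 'a set set" where
  "borel_sets_of X = sigma_sets (topspace X) {U. openin X U}"

definition Sym_plus :: "(real^'n^'n) set" where
  "Sym_plus = {A. transpose A = A \<and> (\<forall>v. 0 \<le> v \<bullet> (A *v v))}"

definition frobenius :: "real^'n^'m \<Rightarrow> real^'n^'m \<Rightarrow> real" (infixl \<open>:\<^sub>F\<close> 70) where
  "A :\<^sub>F B = (\<Sum>i\<in>UNIV. \<Sum>j\<in>UNIV. A $ i $ j * B $ i $ j)"

definition grad :: "(real^'n \<Rightarrow> real) \<Rightarrow> real^'n \<Rightarrow> real^'n" where
  "grad \<phi> x = (\<chi> i. frechet_derivative \<phi> (at x) (axis i 1))"

definition hessian :: "(real^'n \<Rightarrow> real) \<Rightarrow> real^'n \<Rightarrow> real^'n^'n" where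
  "hessian \<phi> x = jacobian (grad \<phi>) (at x)"

text \<open>A test function on \<open>(0,T)\<close> is identified with its extension by zero to the real line.\<close>

definition C1c :: "real \<Rightarrow> (real \<Rightarrow> real) set" where
  "C1c T = {\<xi>. \<xi> C1_differentiable_on UNIV \<and>
     compact (closure {t. \<xi> t \<noteq> 0}) \<and> closure {t. \<xi> t \<noteq> 0} \<subseteq> {0<..<T}}"

definition C2c :: "(real^'n \<Rightarrow> real) set" where
  "C2c = {\<phi>. (\<forall>x. \<phi> differentiable at x) \<and> (\<forall>x. grad \<phi> differentiable at x) \<and>
     continuous_on UNIV (hessian \<phi>) \<and> compact (closure {x. \<phi> x \<noteq> 0})}"

definition KFP_operator ::
  "(real \<Rightarrow> real^'n \<Rightarrow> (real^'n) prob_measure \<Rightarrow> real^'n) \<Rightarrow>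
   (real \<Rightarrow> real^'n \<Rightarrow> (real^'n) prob_measure \<Rightarrow> real^'n^'n) \<Rightarrow>
   (real \<Rightarrow> (real^'n) prob_measure) \<Rightarrow> real \<Rightarrow> (real^'n \<Rightarrow> real) \<Rightarrow> real^'n \<Rightarrow> real" where
  "KFP_operator b a \<mu> t \<phi> x =
     1 / 2 * (a t x (\<mu> t) :\<^sub>F hessian \<phi> x) + b t x (\<mu> t) \<bullet> grad \<phi> x"

text \<open>The norm on \<^typ>\<open>real^'n^'n\<close> is the Frobenius norm. In the weak equation, the inner integral
  on the right is well defined for almost every \<open>t\<close> by the integrability condition.\<close>

definition KFP ::
  "real \<Rightarrow> (real \<Rightarrow> real^'n \<Rightarrow> (real^'n) prob_measure \<Rightarrow> real^'n) \<Rightarrow>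
   (real \<Rightarrow> real^'n \<Rightarrow> (real^'n) prob_measure \<Rightarrow> real^'n^'n) \<Rightarrow>
   (real \<Rightarrow> (real^'n) prob_measure) set" where
  "KFP T b a = {\<mu> \<in> cont_paths T.
     (\<integral>\<^sup>+t\<in>{0..T}. (\<integral>\<^sup>+x. ennreal (norm (b t x (\<mu> t)) / (1 + norm x)
          + norm (a t x (\<mu> t)) / (1 + (norm x)\<^sup>2)) \<partial>the_measure (\<mu> t)) \<partial>lborel) < \<infinity> \<and>
     (\<forall>\<xi>\<in>C1c T. \<forall>\<phi>\<in>C2c.
        (\<integral>t\<in>{0..T}. deriv \<xi> t * (\<integral>x. \<phi> x \<partial>the_measure (\<mu> t)) \<partial>lborel) =
        - (\<integral>t\<in>{0..T}. \<xi> t * (\<integral>x. KFP_operator b a \<mu> t \<phi> x \<partial>the_measure (\<mu> t)) \<partial>lborel))}"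

end

theory Submission
  imports Defs "HOL-Real_Asymp.Real_Asymp"
begin

text \<open>The narrow topology on probability measures over a separable metric space is second countable,
  so the evaluation \<open>(\<gamma>, t) \<mapsto> \<gamma> t\<close> is jointly measurable into a space where Borel sets of products
  are generated by rectangles, and all integrals occurring in the definition of \<open>KFP\<close> are Borel
  functions of the path \<open>\<gamma>\<close>. Test functions with support in a fixed compact set form a separable
  family in the \<open>C\<^sup>1\<close> and \<open>C\<^sup>2\<close> norms, and for a path of finite energy both sides of the weak equation
  pass to the limit by dominated convergence. Hence countably many test functions suffice.\<close>

subsection \<open>Second countability of the narrow topology\<close>

text \<open>Of the compact-open topology the proof uses that evaluation at a fixed time pulls open
  sets back to open sets; joint measurability in path and time then comes from continuity of each
  path. The delicate term is the right-hand side of the weak equation. For a path of infinite energy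
  the operator may fail to be integrable, and the default value of the Bochner integral does not
  pass to limits. The term is still a Borel function of the path, and finite energy is itself one of
  the conditions defining \<open>KFP\<close>, so the reduction to countably many test functions
  takes place inside the Borel set of paths of finite energy. The weights in the energy decay in
  space, so approximating test functions must keep their supports in one common ball for the energy
  to dominate them. Paths and coefficients are given on [0,T] only: times are clamped and
  coefficients extended by zero, which leaves every integral over [0,T] unchanged.\<close>

lemma prob_space_the_measure [simp, intro]: "prob_space (the_measure \<mu>)"
  using the_measure[of \<mu>] by simp

lemma sets_the_measure [simp, measurable_cong]: "sets (the_measure \<mu>) = sets borel"
  using the_measure[of \<mu>] by simp

lemma space_the_measure [simp]: "space (the_measure \<mu>) = UNIV"
  using sets_eq_imp_space_eq[OF sets_the_measure] by simp

lemma measurable_the_measure_eq [simp]: "measurable (the_measure \<mu>) N = measurable borel N"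
  by (rule measurable_cong_sets) simp_all

lemma finite_measure_the_measure [simp, intro]: "finite_measure (the_measure \<mu>)"
  by (rule prob_space.finite_measure) simp

lemma integrable_the_measure:
  fixes f :: "'a::topological_space \<Rightarrow> real"
  assumes "continuous_on UNIV f" "bounded (range f)"
  shows "integrable (the_measure \<mu>) f"
proof -
  obtain B where "\<And>x. norm (f x) \<le> B"
    using assms(2) by (auto simp: bounded_iff)
  moreover have "f \<in> borel_measurable (the_measure \<mu>)"
    using borel_measurable_continuous_onI[OF assms(1)] by simp
  ultimately show ?thesis
    by (intro finite_measure.integrable_const_bound[where B = B]) auto
qed

lemma continuous_on_integral_the_measure:
  fixes f :: "'a::topological_space \<Rightarrow> real"
  assumes "continuous_on UNIV f" "bounded (range f)"
  shows "continuous_on UNIV (\<lambda>\<mu>. \<integral>x. f x \<partial>the_measure \<mu>)"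
proof -
  have "open ((\<lambda>\<mu>. \<integral>x. f x \<partial>the_measure \<mu>) -` U)" if "open U" for U
    unfolding open_prob_measure_def vimage_def
    using assms that by (intro generate_topology.Basis) blast
  then show ?thesis
    by (simp add: continuous_on_open_vimage)
qed

text \<open>A nonnegative continuous \<open>f\<close> is a supremum of spikes with rational parameters below it. Finite
  maxima of these form a countable family whose integrals are a subbase of the narrow topology.\<close>

definition spike :: "'a::metric_space \<times> real \<times> nat \<Rightarrow> 'a \<Rightarrow> real" where
  "spike = (\<lambda>(z, q, m) x. max 0 (q - real m * dist x z))"

definition spikes :: "('a::metric_space \<times> real \<times> nat) list \<Rightarrow> 'a \<Rightarrow> real" where
  "spikes ps x = foldr (\<lambda>p. max (spike p x)) ps 0"

lemma continuous_on_spikes [continuous_intros]: "continuous_on UNIV (spikes ps)"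
  unfolding spikes_def spike_def
  by (induction ps) (auto intro!: continuous_intros simp: case_prod_beta)

lemma spikes_nonneg: "0 \<le> spikes ps x"
  unfolding spikes_def by (induction ps) (auto simp: max_def)

lemma spikes_ge: "p \<in> set ps \<Longrightarrow> spike p x \<le> spikes ps x"
  unfolding spikes_def by (induction ps) auto

lemma spikes_le: "0 \<le> c \<Longrightarrow> (\<And>p. p \<in> set ps \<Longrightarrow> spike p x \<le> c) \<Longrightarrow> spikes ps x \<le> c"
  unfolding spikes_def by (induction ps) auto

text \<open>The slope of a spike is nonnegative, so its height bounds it, and the sum of the
  absolute heights in the list bounds all its spikes at once.\<close>

lemma bounded_spikes: "bounded (range (spikes ps))"
proof -
  have "spike p x \<le> \<bar>fst (snd p)\<bar>" for p and x :: 'a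
    by (auto simp: spike_def case_prod_beta) (smt (verit) mult_nonneg_nonneg of_nat_0_le_iff zero_le_dist)
  moreover have "\<bar>fst (snd p)\<bar> \<le> (\<Sum>p\<leftarrow>ps. \<bar>fst (snd p)\<bar>)" if "p \<in> set ps" for p
    using that by (intro member_le_sum_list) auto
  ultimately have "spikes ps x \<le> (\<Sum>p\<leftarrow>ps. \<bar>fst (snd p)\<bar>)" for x
    by (intro spikes_le sum_list_nonneg) (force, meson order_trans)
  then show ?thesis
    using spikes_nonneg[of ps] by (intro boundedI[of _ "\<Sum>p\<leftarrow>ps. \<bar>fst (snd p)\<bar>"]) auto
qed

text \<open>A spike is a cone with apex \<open>z\<close>, height \<open>q\<close> and slope
  \<open>m\<close>. By continuity \<open>f\<close> exceeds \<open>q\<close> near \<open>x\<close>; a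
  steep cone with apex close to \<open>x\<close> dies out inside that neighbourhood and still
  exceeds \<open>c\<close> at \<open>x\<close>.\<close>

lemma spike_approximation:
  fixes f :: "'a::metric_space \<Rightarrow> real"
  assumes f: "continuous_on UNIV f" "\<And>x. 0 \<le> f x"
    and D: "\<And>U::'a set. open U \<Longrightarrow> U \<noteq> {} \<Longrightarrow> \<exists>d\<in>D. d \<in> U"
    and c: "c < f x"
  shows "\<exists>p \<in> D \<times> \<rat> \<times> UNIV. (\<forall>y. spike p y \<le> f y) \<and> c < spike p x"
proof (cases "c < 0")
  \<comment> \<open>Height and slope 0 give the zero function, which lies below \<open>f\<close> and
    above \<open>c\<close>. In the other case \<open>c \<ge> 0\<close> forces
    \<open>q > 0\<close>.\<close>
  case True
  obtain z where "z \<in> D"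
    using D[of UNIV] by auto
  then have "(z, 0, 0) \<in> D \<times> \<rat> \<times> (UNIV :: nat set)"
    by auto
  then show ?thesis
    by (intro bexI[of _ "(z, 0, 0)"]) (use True f in \<open>auto simp: spike_def\<close>)
next
  case False
  obtain q where q: "q \<in> \<rat>" "c < q" "q < f x"
    using Rats_dense_in_real[OF c] by auto
  have "eventually (\<lambda>y. q < f y) (at x)"
    using f(1) q(3) by (auto simp: continuous_on_def intro: order_tendstoD)
  then obtain \<delta> where \<delta>: "\<delta> > 0" "\<And>y. dist y x < \<delta> \<Longrightarrow> q < f y"
    using q(3) by (auto simp: eventually_at) (metis)
  \<comment> \<open>With this slope the cone has come down to 0 at distance \<delta>/2 from its
    apex.\<close>
  obtain m :: nat where m: "2 * q / \<delta> < real m"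
    using reals_Archimedean2 by blast
  \<comment> \<open>The first bound keeps the \<delta>/2-ball around the apex inside the
    \<delta>-ball around \<open>x\<close>. The second makes the loss \<open>m * dist x z\<close> at
    \<open>x\<close> strictly smaller than \<open>q - c\<close>; the added 1 gives the
    strictness.\<close>
  define r where "r = min (\<delta> / 2) ((q - c) / (real m + 1))"
  have "r > 0"
    using \<delta> q by (auto simp: r_def)
  then obtain z where z: "z \<in> D" "dist x z < r"
    using D[of "ball x r"] by auto
  have "spike (z, q, m) y \<le> f y" for y
  proof (cases "dist y z < \<delta> / 2")
    case True
    then have "dist y x < \<delta>"
      using z(2) dist_triangle2[of y x z] by (auto simp: r_def)
    then have "q < f y" by (rule \<delta>)
    then show ?thesis
      using f(2)[of y] by (simp add: spike_def) (smt (verit) mult_nonneg_nonneg of_nat_0_le_iff zero_le_dist)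
  next
    case False
    have "q \<le> real m * (\<delta> / 2)"
      using m \<delta>(1) by (simp add: field_simps)
    also have "\<dots> \<le> real m * dist y z"
      using False by (intro mult_left_mono) auto
    finally show ?thesis
      using f(2)[of y] by (simp add: spike_def)
  qed
  moreover have "c < spike (z, q, m) x"
  proof -
    have "real m * dist x z \<le> real m * ((q - c) / (real m + 1))"
      using z(2) by (intro mult_left_mono) (auto simp: r_def)
    also have "\<dots> < q - c"
      using q by (simp add: field_simps)
    finally show ?thesis
      by (simp add: spike_def)
  qed
  ultimately show ?thesis
    using z q by (intro bexI[of _ "(z, q, m)"]) auto
qed

text \<open>The spikes below \<open>f\<close> are countably many and have supremum \<open>f\<close>,
  so the running maxima along an enumeration increase to \<open>f\<close>. Dominated convergence,
  with \<open>f\<close> itself as dominating function, carries this over to the integrals.\<close>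

lemma integral_approx_spikes:
  fixes f :: "'a::metric_space \<Rightarrow> real"
  assumes f: "continuous_on UNIV f" "\<And>x. 0 \<le> f x" "bounded (range f)"
    and D: "\<And>U::'a set. open U \<Longrightarrow> U \<noteq> {} \<Longrightarrow> \<exists>d\<in>D. d \<in> U"
    and "countable D"
    and c: "c < (\<integral>x. f x \<partial>the_measure \<mu>)"
  shows "\<exists>ps \<in> lists (D \<times> \<rat> \<times> UNIV). (\<forall>x. spikes ps x \<le> f x) \<and>
    c < (\<integral>x. spikes ps x \<partial>the_measure \<mu>)"
proof -
  define S where "S = {p \<in> D \<times> \<rat> \<times> UNIV. \<forall>y. spike p y \<le> f y}"
  have "S \<subseteq> D \<times> \<rat> \<times> UNIV"
    unfolding S_def by blast
  moreover have "countable (D \<times> (\<rat> :: real set) \<times> (UNIV :: nat set))"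
    by (intro countable_SIGMA \<open>countable D\<close> countable_rat countableI_type)
  ultimately have "countable S"
    by (rule countable_subset)
  \<comment> \<open>\<open>from_nat_into S\<close> takes its values in \<open>S\<close> only if
    \<open>S\<close> is nonempty. Any point and any level below \<open>f\<close> there provide a
    member.\<close>
  have "S \<noteq> {}"
    using spike_approximation[OF f(1,2) D, of "f undefined - 1" undefined] by (auto simp: S_def)
  define h where "h n = spikes (map (from_nat_into S) [0..<n])" for n
  have S: "from_nat_into S n \<in> S" for n
    by (rule from_nat_into) fact
  have h_le: "h n x \<le> f x" for n x
    unfolding h_def using S f(2) by (intro spikes_le) (auto simp: S_def)
  have h_lim: "(\<lambda>n. h n x) \<longlonglongrightarrow> f x" for x
  proof (rule increasing_tendsto)
    fix c assume "c < f x"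
    then obtain p where "p \<in> S" "c < spike p x"
      using spike_approximation[OF f(1,2) D] by (fastforce simp: S_def)
    then obtain k where k: "p = from_nat_into S k"
      using \<open>countable S\<close> from_nat_into_surj by metis
    have "c < h n x" if "n > k" for n
      using spikes_ge[of p "map (from_nat_into S) [0..<n]" x] k that \<open>c < spike p x\<close>
      by (force simp: h_def)
    then show "eventually (\<lambda>n. c < h n x) sequentially"
      using eventually_gt_at_top[of k] by (rule eventually_mono[rotated])
  qed (simp add: h_le)
  have "(\<lambda>n. \<integral>x. h n x \<partial>the_measure \<mu>) \<longlonglongrightarrow> (\<integral>x. f x \<partial>the_measure \<mu>)"
  proof (rule integral_dominated_convergence[where w = f])
    show "f \<in> borel_measurable (the_measure \<mu>)" "h n \<in> borel_measurable (the_measure \<mu>)" for n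
      using borel_measurable_continuous_onI[OF f(1)]
        borel_measurable_continuous_onI[OF continuous_on_spikes] by (simp_all add: h_def)
    show "integrable (the_measure \<mu>) f"
      by (rule integrable_the_measure) fact+
    show "AE x in the_measure \<mu>. norm (h n x) \<le> f x" for n
      using h_le[of n] by (intro AE_I2) (simp add: h_def abs_of_nonneg spikes_nonneg)
  qed (simp add: h_lim)
  then have "eventually (\<lambda>n. c < (\<integral>x. h n x \<partial>the_measure \<mu>)) sequentially"
    using c by (rule order_tendstoD)
  then obtain n where "c < (\<integral>x. h n x \<partial>the_measure \<mu>)"
    by (auto dest: eventually_happens)
  moreover have "map (from_nat_into S) [0..<n] \<in> lists (D \<times> \<rat> \<times> UNIV)"
    using S unfolding S_def in_lists_conv_set set_map by blast
  ultimately show ?thesis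
    using h_le unfolding h_def by blast
qed

text \<open>The class asks for a countable subbase only. Superlevel sets at rational levels suffice:
  real levels are unions of these, nonnegative integrands are reached from below by
  \<open>spikes\<close>, a bounded integrand becomes nonnegative after adding a constant, and
  sublevel sets are superlevel sets of the negated integrand.\<close>

instance prob_measure :: ("{metric_space, second_countable_topology}") second_countable_topology
proof
  obtain D :: "'a set" where D: "countable D"
      "\<And>U. open U \<Longrightarrow> U \<noteq> {} \<Longrightarrow> \<exists>d\<in>D. d \<in> U"
    by (rule countable_dense_setE) blast
  define P where "P = lists (D \<times> (\<rat> :: real set) \<times> (UNIV :: nat set))"
  define \<B> where "\<B> = (\<lambda>p. {\<mu>. snd p < (\<integral>x. spikes (fst p) x \<partial>the_measure \<mu>)}) ` (P \<times> \<rat>)"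
  let ?S = "{{\<mu>. (\<integral>x. f x \<partial>the_measure \<mu>) \<in> U} |(f :: 'a \<Rightarrow> real) U.
        continuous_on UNIV f \<and> bounded (range f) \<and> open U}"
  have "countable \<B>"
    unfolding \<B>_def P_def using D(1) countable_rat
    by (intro countable_image countable_SIGMA countable_lists) auto
  have spikes: "generate_topology \<B> {\<mu>. c < (\<integral>x. spikes ps x \<partial>the_measure \<mu>)}" if "ps \<in> P" for ps c
  proof -
    have "{\<mu>. c < (\<integral>x. spikes ps x \<partial>the_measure \<mu>)} =
        (\<Union>q\<in>{q\<in>\<rat>. c < q}. {\<mu>. q < (\<integral>x. spikes ps x \<partial>the_measure \<mu>)})"
      by (auto dest: Rats_dense_in_real intro: less_trans)
    also have "generate_topology \<B> \<dots>"
      using that by (intro generate_topology_Union generate_topology.Basis) (force simp: \<B>_def)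
    finally show ?thesis .
  qed
  have lsc_nonneg: "generate_topology \<B> {\<mu>. c < (\<integral>x. f x \<partial>the_measure \<mu>)}"
    if f: "continuous_on UNIV f" "\<And>x. 0 \<le> f x" "bounded (range f)" for f :: "'a \<Rightarrow> real" and c
  proof -
    have "(\<integral>x. spikes ps x \<partial>the_measure \<mu>) \<le> (\<integral>x. f x \<partial>the_measure \<mu>)"
      if "\<And>x. spikes ps x \<le> f x" for ps \<mu>
      using that f by (intro integral_mono integrable_the_measure continuous_on_spikes bounded_spikes)
    then have "c < (\<integral>x. f x \<partial>the_measure \<mu>) \<longleftrightarrow>
        (\<exists>ps\<in>P. (\<forall>x. spikes ps x \<le> f x) \<and> c < (\<integral>x. spikes ps x \<partial>the_measure \<mu>))" for \<mu>
      using integral_approx_spikes[OF f D(2,1), of c \<mu>] less_le_trans[of c]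
      unfolding P_def by blast
    then have "{\<mu>. c < (\<integral>x. f x \<partial>the_measure \<mu>)} =
        (\<Union>ps\<in>{ps\<in>P. \<forall>x. spikes ps x \<le> f x}. {\<mu>. c < (\<integral>x. spikes ps x \<partial>the_measure \<mu>)})"
      by auto
    also have "generate_topology \<B> \<dots>"
      by (intro generate_topology_Union spikes) auto
    finally show ?thesis .
  qed
  have lsc: "generate_topology \<B> {\<mu>. c < (\<integral>x. f x \<partial>the_measure \<mu>)}"
    if f: "continuous_on UNIV f" "bounded (range f)" for f :: "'a \<Rightarrow> real" and c
  proof -
    obtain C where C: "\<And>x. norm (f x) \<le> C"
      using f(2) by (auto simp: bounded_iff)
    \<comment> \<open>Total mass one makes the shift of the level the same for every \<mu>.\<close>
    have "(\<integral>x. f x + C \<partial>the_measure \<mu>) = (\<integral>x. f x \<partial>the_measure \<mu>) + C" for \<mu>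
      using prob_space.prob_space[OF prob_space_the_measure, of \<mu>] integrable_the_measure[OF f]
        finite_measure.integrable_const[OF finite_measure_the_measure]
      by (subst Bochner_Integration.integral_add) auto
    then have "{\<mu>. c < (\<integral>x. f x \<partial>the_measure \<mu>)} = {\<mu>. c + C < (\<integral>x. f x + C \<partial>the_measure \<mu>)}"
      by simp
    moreover have "bounded (range (\<lambda>x. f x + C))"
      using bounded_translation[OF f(2), of C] by (simp add: image_image add.commute)
    moreover have "0 \<le> f x + C" for x
      using C[of x] by (simp add: abs_le_iff)
    ultimately show ?thesis
      using lsc_nonneg[of "\<lambda>x. f x + C" "c + C"] continuous_on_add[OF f(1) continuous_on_const, of C]
      by simp
  qed
  have usc: "generate_topology \<B> {\<mu>. (\<integral>x. f x \<partial>the_measure \<mu>) < c}"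
    if f: "continuous_on UNIV f" "bounded (range f)" for f :: "'a \<Rightarrow> real" and c
  proof -
    have "bounded (range (\<lambda>x. - f x))"
      using f(2) by (simp add: bounded_iff)
    then show ?thesis
      using lsc[of "\<lambda>x. - f x" "- c"] continuous_on_minus[OF f(1)] by simp
  qed
  have "generate_topology \<B> {\<mu>. (\<integral>x. f x \<partial>the_measure \<mu>) \<in> U}"
    if f: "continuous_on UNIV f" "bounded (range f)" and "open U" for f :: "'a \<Rightarrow> real" and U
    \<comment> \<open>Open sets of reals are generated by open rays, whose preimages are the sets in
      \<open>lsc\<close> and \<open>usc\<close>.\<close>
    using \<open>open U\<close> unfolding open_generated_order
  proof induction
    case (Int A B)
    then show ?case
      using generate_topology.Int by (simp add: Collect_conj_eq)
  next
    case (UN K)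
    then have "generate_topology \<B> (\<Union>V\<in>K. {\<mu>. (\<integral>x. f x \<partial>the_measure \<mu>) \<in> V})"
      by (intro generate_topology_Union) auto
    then show ?case
      by (rule back_subst) auto
  qed (use lsc[OF f] usc[OF f] in \<open>auto intro: generate_topology.UNIV\<close>)
  then have basis: "generate_topology \<B> V" if "V \<in> ?S" for V
    using that by (elim CollectE exE conjE) simp
  have "generate_topology \<B> V" if "open V" for V
    using that unfolding open_prob_measure_def
  proof (induction rule: generate_topology.induct)
    case (Basis V)
    then show ?case by (rule basis)
  qed (blast intro: generate_topology.intros)+
  moreover have basic: "open V" if V: "V \<in> \<B>" for V
  proof -
    obtain p where "V = {\<mu>. snd p < (\<integral>x. spikes (fst p) x \<partial>the_measure \<mu>)}"
      using V unfolding \<B>_def by blast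
    then have "V = {\<mu>. (\<integral>x. spikes (fst p) x \<partial>the_measure \<mu>) \<in> {snd p<..}}"
      by simp
    then have "V \<in> ?S"
      by (intro CollectI exI[of _ "spikes (fst p)"] exI[of _ "{snd p<..}"])
        (simp add: continuous_on_spikes bounded_spikes)
    then show ?thesis
      unfolding open_prob_measure_def by (rule generate_topology.Basis)
  qed
  have "open V" if "generate_topology \<B> V" for V
    using that
  proof (induction rule: generate_topology.induct)
    case (Basis V)
    then show ?case by (rule basic)
  qed auto
  ultimately show "\<exists>B :: 'a prob_measure set set. countable B \<and> open = generate_topology B"
    using \<open>countable \<B>\<close> by blast
qed

subsection \<open>Measurability of evaluation and of integrals along paths\<close>

text \<open>In a second countable space every subbase, even an uncountable one, generates the Borel
  sets. The defining subbase of the narrow topology can therefore be tested directly.\<close>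

lemma measurable_prob_measureI:
  fixes X :: "'w \<Rightarrow> 'a::{metric_space, second_countable_topology} prob_measure"
  assumes "\<And>f :: 'a \<Rightarrow> real. continuous_on UNIV f \<Longrightarrow> bounded (range f) \<Longrightarrow>
    (\<lambda>\<omega>. \<integral>x. f x \<partial>the_measure (X \<omega>)) \<in> borel_measurable M"
  shows "X \<in> borel_measurable M"
proof -
  have eq: "(open :: 'a prob_measure set \<Rightarrow> bool) = generate_topology
     {{\<mu>. (\<integral>x. f x \<partial>the_measure \<mu>) \<in> U} |(f :: 'a \<Rightarrow> real) U.
        continuous_on UNIV f \<and> bounded (range f) \<and> open U}"
    by (rule ext) (simp add: open_prob_measure_def)
  show ?thesis
    unfolding second_countable_borel_measurable[OF eq]
  proof (rule measurable_measure_of)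
    fix A :: "'a prob_measure set"
    assume "A \<in> {{\<mu>. (\<integral>x. f x \<partial>the_measure \<mu>) \<in> U} |(f :: 'a \<Rightarrow> real) U.
        continuous_on UNIV f \<and> bounded (range f) \<and> open U}"
    then obtain f :: "'a \<Rightarrow> real" and U
      where f: "continuous_on UNIV f" "bounded (range f)" and U: "open U"
        and A: "A = {\<mu>. (\<integral>x. f x \<partial>the_measure \<mu>) \<in> U}"
      by auto
    show "X -` A \<inter> space M \<in> sets M"
      using measurable_sets[OF assms[OF f] borel_open[OF U]] by (simp add: A vimage_def)
  qed auto
qed

text \<open>This links the narrow topology with the kernels of the library. Open sets form an
  intersection-stable generator, and the mass of an open set is a limit of integrals of bounded
  continuous functions, each continuous in \<mu>.\<close>

lemma measurable_the_measure [measurable]: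
  "the_measure \<in> borel \<rightarrow>\<^sub>M subprob_algebra (borel :: 'a::{metric_space, second_countable_topology} measure)"
proof (rule measurable_subprob_algebra_generated[where \<Omega> = UNIV and G = "{U. open U}"])
  show "sets borel = sigma_sets UNIV {U :: 'a set. open U}"
    by (simp add: borel_def)
  show "Int_stable {U :: 'a set. open U}"
    by (auto simp: Int_stable_def)
  show "subprob_space (the_measure \<mu>)" for \<mu> :: "'a prob_measure"
    by (intro prob_space_imp_subprob_space) simp
  have one: "emeasure (the_measure \<mu>) UNIV = 1" for \<mu> :: "'a prob_measure"
    using prob_space.emeasure_space_1[OF prob_space_the_measure, of \<mu>] by simp
  then show "(\<lambda>\<mu>. emeasure (the_measure \<mu>) (UNIV :: 'a set)) \<in> borel_measurable borel"
    by simp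
  fix G :: "'a set"
  assume "G \<in> {U. open U}"
  then have "open G" by simp
  show "(\<lambda>\<mu>. emeasure (the_measure \<mu>) G) \<in> borel_measurable borel"
  \<comment> \<open>The distance to the empty set is 0 by convention, so for \<open>G = UNIV\<close>
    the approximating functions would vanish.\<close>
  proof (cases "G = UNIV")
    case False
    define f where "f n x = min 1 (real n * infdist x (- G))" for n x
    have f: "continuous_on UNIV (f n)" "bounded (range (f n))" for n
      by (auto simp: f_def abs_le_iff infdist_nonneg min_le_iff_disj
          intro!: continuous_intros boundedI[of _ 1])
    have lim: "(\<lambda>n. f n x) \<longlonglongrightarrow> indicator G x" for x
    proof (cases "x \<in> G")
      case True
      then have "infdist x (- G) > 0"
        using \<open>open G\<close> False infdist_pos_not_in_closed[of "- G" x] by auto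
      then obtain k :: nat where "1 / infdist x (- G) < real k"
        using reals_Archimedean2 by blast
      then have "1 \<le> real k * infdist x (- G)"
        using \<open>infdist x (- G) > 0\<close> by (simp add: divide_less_eq)
      then have "1 \<le> real n * infdist x (- G)" if "n \<ge> k" for n
        by (rule order_trans) (use that in \<open>auto intro: mult_right_mono infdist_nonneg\<close>)
      then have "eventually (\<lambda>n. indicator G x = f n x) sequentially"
        using True by (intro eventually_sequentiallyI[of k]) (auto simp: f_def)
      then show ?thesis
        by (rule Lim_transform_eventually[OF tendsto_const])
    qed (simp add: f_def)
    have "(\<lambda>\<mu>. measure (the_measure \<mu>) G) \<in> borel_measurable borel"
    proof (rule borel_measurable_LIMSEQ_real)
      show "(\<lambda>\<mu>. \<integral>x. f n x \<partial>the_measure \<mu>) \<in> borel_measurable borel" for n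
        using f by (intro borel_measurable_continuous_onI continuous_on_integral_the_measure)
      fix \<mu> :: "'a prob_measure"
      have "(\<lambda>n. \<integral>x. f n x \<partial>the_measure \<mu>) \<longlonglongrightarrow> (\<integral>x. indicator G x \<partial>the_measure \<mu>)"
      proof (rule integral_dominated_convergence[where w = "\<lambda>_. 1"])
        show "f n \<in> borel_measurable (the_measure \<mu>)" for n
          using borel_measurable_continuous_onI[OF f(1)] by simp
        show "integrable (the_measure \<mu>) (\<lambda>_. 1 :: real)"
          by (rule finite_measure.integrable_const) simp
        show "indicator G \<in> borel_measurable (the_measure \<mu>)"
          using \<open>open G\<close> by simp
        show "AE x in the_measure \<mu>. norm (f n x) \<le> 1" for n
          by (simp add: f_def infdist_nonneg abs_le_iff min_le_iff_disj)
      qed (simp add: lim)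
      then show "(\<lambda>n. \<integral>x. f n x \<partial>the_measure \<mu>) \<longlonglongrightarrow> measure (the_measure \<mu>) G"
        by simp
    qed
    then show ?thesis
      by (simp add: finite_measure.emeasure_eq_measure)
  qed (simp add: one)
qed auto

section \<open>Measurability on the path space\<close>

text \<open>The compact-open topology is a topology value on a subset of a function type, so
  \<open>borel\<close> does not denote its Borel sets. Packing them into a measure makes the
  measurability rules applicable.\<close>

definition path_measure :: "real \<Rightarrow> (real \<Rightarrow> 'a::topological_space) measure" where
  "path_measure T = sigma (cont_paths T) {U. openin (compact_open_topology T) U}"

lemma path_measure_generator: "{U. openin (compact_open_topology T) U} \<subseteq> Pow (cont_paths T)"
  by (metis CollectD PowI openin_subset subsetI topspace_compact_open_topology)

lemma space_path_measure [simp]: "space (path_measure T) = cont_paths T"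
  unfolding path_measure_def by (rule space_measure_of) (rule path_measure_generator)

lemma sets_path_measure: "sets (path_measure T) = borel_sets_of (compact_open_topology T)"
  unfolding path_measure_def borel_sets_of_def
  using sets_measure_of[OF path_measure_generator[of T]] by simp

text \<open>A single time is a compact set, so these preimages are subbasic open sets of the
  compact-open topology.\<close>

lemma measurable_evaluation:
  assumes "t \<in> {0..T}"
  shows "(\<lambda>\<gamma>. \<gamma> t) \<in> borel_measurable (path_measure T)"
proof (rule borel_measurableI)
  fix U :: "'a set"
  assume "open U"
  then have "openin (compact_open_topology T) {\<gamma> \<in> cont_paths T. \<gamma> ` {t} \<subseteq> U}"
    using assms unfolding compact_open_topology_def
    by (intro topology_generated_by_Basis CollectI exI[of _ "{t}"] exI[of _ U]) auto
  then show "(\<lambda>\<gamma>. \<gamma> t) -` U \<inter> space (path_measure T) \<in> sets (path_measure T)"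
    unfolding sets_path_measure borel_sets_of_def
    by (intro sigma_sets.Basic) (simp add: vimage_def Int_def conj_commute)
qed

text \<open>Clamping the time to [0,T] makes evaluation meaningful for all real times and continuous
  in time for each continuous path, although paths are \<open>undefined\<close> outside
  [0,T].\<close>

definition path_at :: "real \<Rightarrow> (real \<Rightarrow> 'a) \<Rightarrow> real \<Rightarrow> 'a" where
  "path_at T \<gamma> t = \<gamma> (max 0 (min T t))"

lemma path_at_eq [simp]: "t \<in> {0..T} \<Longrightarrow> path_at T \<gamma> t = \<gamma> t"
  by (simp add: path_at_def)

text \<open>A function measurable in the path and continuous in time is jointly measurable, by
  discretizing time. Working with the real functions \<open>F\<close> reduces the limit to one of
  real-valued maps.\<close>

lemma measurable_path_at [measurable]:
  assumes "T \<ge> 0"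
  shows "(\<lambda>(\<gamma>, t). path_at T \<gamma> t) \<in>
    path_measure T \<Otimes>\<^sub>M borel \<rightarrow>\<^sub>M (borel :: 'a::{metric_space, second_countable_topology} prob_measure measure)"
proof (rule measurable_prob_measureI)
  fix f :: "'a \<Rightarrow> real"
  assume f: "continuous_on UNIV f" "bounded (range f)"
  define c where "c t = max 0 (min T t)" for t
  define F where "F \<mu> = (\<integral>x. f x \<partial>the_measure \<mu>)" for \<mu>
  have F: "continuous_on UNIV F"
    unfolding F_def by (rule continuous_on_integral_the_measure) fact+
  have [measurable]: "F \<in> borel_measurable borel"
    by (rule borel_measurable_continuous_onI) fact
  have c: "c t \<in> {0..T}" for t
    using assms by (auto simp: c_def)
  have "(\<lambda>(\<gamma>, t). F (\<gamma> (c t))) \<in> borel_measurable (path_measure T \<Otimes>\<^sub>M borel)"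
  proof (rule borel_measurable_LIMSEQ_real)
    fix n :: nat
    have [measurable]: "(\<lambda>\<gamma>. \<gamma> (c s)) \<in> path_measure T \<rightarrow>\<^sub>M (borel :: 'a prob_measure measure)" for s
      by (rule measurable_evaluation) (rule c)
    have "(\<lambda>p. F (fst p (c (real_of_int i / real (Suc n)))))
        \<in> borel_measurable (path_measure T \<Otimes>\<^sub>M (borel :: real measure))" for i
      by measurable
    moreover have "(\<lambda>p. \<lfloor>real (Suc n) * snd p\<rfloor>)
        \<in> path_measure T \<Otimes>\<^sub>M borel \<rightarrow>\<^sub>M count_space UNIV"
      by measurable
    \<comment> \<open>On the grid of mesh \<open>1 / Suc n\<close> only countably many times occur,
      selected by a measurable integer, so measurability at fixed times is enough.\<close>
    ultimately have "(\<lambda>p. F (fst p (c (real_of_int \<lfloor>real (Suc n) * snd p\<rfloor> / real (Suc n)))))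
        \<in> borel_measurable (path_measure T \<Otimes>\<^sub>M borel)"
      by (rule measurable_compose_countable)
    then show "(\<lambda>(\<gamma>, t). F (\<gamma> (c (real_of_int \<lfloor>real (Suc n) * t\<rfloor> / real (Suc n)))))
        \<in> borel_measurable (path_measure T \<Otimes>\<^sub>M borel)"
      by (simp add: case_prod_unfold)
  next
    fix p :: "(real \<Rightarrow> 'a prob_measure) \<times> real"
    assume "p \<in> space (path_measure T \<Otimes>\<^sub>M borel)"
    then obtain \<gamma> t where p: "p = (\<gamma>, t)" and \<gamma>: "continuous_on {0..T} \<gamma>"
      by (auto simp: space_pair_measure cont_paths_def)
    have "(\<lambda>n. real_of_int \<lfloor>real (Suc n) * t\<rfloor> / real (Suc n)) \<longlonglongrightarrow> t"
      by real_asymp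
    then have lim: "(\<lambda>n. c (real_of_int \<lfloor>real (Suc n) * t\<rfloor> / real (Suc n))) \<longlonglongrightarrow> c t"
      unfolding c_def by (intro tendsto_intros)
    have "continuous_on {0..T} (\<lambda>t. F (\<gamma> t))"
      using continuous_on_compose2[OF F \<gamma>] by simp
    from continuous_on_tendsto_compose[OF this lim c]
    show "(\<lambda>n. case p of (\<gamma>, t) \<Rightarrow> F (\<gamma> (c (real_of_int \<lfloor>real (Suc n) * t\<rfloor> / real (Suc n)))))
        \<longlonglongrightarrow> (case p of (\<gamma>, t) \<Rightarrow> F (\<gamma> (c t)))"
      using c by (simp add: p)
  qed
  then show "(\<lambda>p. \<integral>x. f x \<partial>the_measure (case p of (\<gamma>, t) \<Rightarrow> path_at T \<gamma> t))
      \<in> borel_measurable (path_measure T \<Otimes>\<^sub>M borel)"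
    by (simp add: F_def path_at_def c_def case_prod_unfold)
qed

lemma measurable_path_kernel [measurable]:
  fixes T :: real
  assumes "T \<ge> 0"
  shows "(\<lambda>(\<gamma>, t). the_measure (path_at T \<gamma> t)) \<in> path_measure T \<Otimes>\<^sub>M borel \<rightarrow>\<^sub>M
     subprob_algebra (borel :: 'a::{metric_space, second_countable_topology} measure)"
  using measurable_compose[OF measurable_path_at[OF assms] measurable_the_measure]
  by (simp add: case_prod_unfold)

lemma measurable_along_path:
  fixes g :: "real \<Rightarrow> 'a::{metric_space, second_countable_topology} \<Rightarrow> 'a prob_measure \<Rightarrow> 'c::topological_space"
  assumes "T \<ge> 0"
    and [measurable]: "(\<lambda>(t, x, \<mu>). g t x \<mu>) \<in> borel_measurable borel"
  shows "(\<lambda>((\<gamma>, t), x). g t x (path_at T \<gamma> t)) \<in>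
    borel_measurable ((path_measure T \<Otimes>\<^sub>M borel) \<Otimes>\<^sub>M borel)"
proof -
  note [measurable] = measurable_path_at[OF assms(1)]
  \<comment> \<open>Borel sets of the product space are traded for the product sigma-algebra.
    \<open>borel_prod\<close> demands second countable factors, which is the purpose of the instance
    for \<open>prob_measure\<close>.\<close>
  have [measurable]: "(\<lambda>(t, x, \<mu>). g t x \<mu>) \<in> borel_measurable (borel \<Otimes>\<^sub>M (borel \<Otimes>\<^sub>M borel))"
    using assms(2) by (simp add: borel_prod)
  have "(\<lambda>p. (\<lambda>(t, x, \<mu>). g t x \<mu>) (snd (fst p), snd p, (\<lambda>(\<gamma>, t). path_at T \<gamma> t) (fst p)))
      \<in> borel_measurable ((path_measure T \<Otimes>\<^sub>M borel) \<Otimes>\<^sub>M borel)"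
    by measurable
  then show ?thesis
    by (simp add: case_prod_unfold)
qed

text \<open>Pushing \<open>L x\<close> forward under \<open>y \<mapsto> (x, y)\<close> moves the
  dependence on \<open>x\<close> from the integrand into the measure. Integrability is not demanded:
  where it fails, both integrals take the default value 0.\<close>

lemma integral_measurable_kernel:
  fixes f :: "'a \<Rightarrow> 'b \<Rightarrow> 'c::{banach, second_countable_topology}"
  assumes f [measurable]: "(\<lambda>(x, y). f x y) \<in> borel_measurable (M \<Otimes>\<^sub>M N)"
    and L [measurable]: "L \<in> measurable M (subprob_algebra N)"
  shows "(\<lambda>x. integral\<^sup>L (L x) (f x)) \<in> borel_measurable M"
proof -
  note measurable_distr2 [measurable]
  have "(\<lambda>x. integral\<^sup>L (distr (L x) (M \<Otimes>\<^sub>M N) (\<lambda>y. (x, y))) (\<lambda>(x, y). f x y)) \<in> borel_measurable M"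
    by measurable
  moreover have "integral\<^sup>L (distr (L x) (M \<Otimes>\<^sub>M N) (\<lambda>y. (x, y))) (\<lambda>(x, y). f x y) = integral\<^sup>L (L x) (f x)"
    if "x \<in> space M" for x
  proof -
    have "sets (L x) = sets N"
      using measurable_space[OF L that] by (simp add: space_subprob_algebra)
    then have "(\<lambda>y. (x, y)) \<in> L x \<rightarrow>\<^sub>M M \<Otimes>\<^sub>M N"
      using measurable_Pair1'[OF that, of N] measurable_cong_sets[of "L x" N "M \<Otimes>\<^sub>M N" "M \<Otimes>\<^sub>M N"]
      by blast
    from integral_distr[OF this f] show ?thesis
      by simp
  qed
  ultimately show ?thesis
    by (rule measurable_cong[THEN iffD1, rotated])
qed

lemma measurable_inner_nn_integral:
  fixes g :: "real \<Rightarrow> 'a::{metric_space, second_countable_topology} \<Rightarrow> 'a prob_measure \<Rightarrow> ennreal"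
  assumes "T \<ge> 0"
    and g: "(\<lambda>(t, x, \<mu>). g t x \<mu>) \<in> borel_measurable borel"
  shows "(\<lambda>(\<gamma>, t). \<integral>\<^sup>+x. g t x (path_at T \<gamma> t) \<partial>the_measure (path_at T \<gamma> t))
    \<in> borel_measurable (path_measure T \<Otimes>\<^sub>M borel)"
proof -
  have "(\<lambda>(p, x). (\<lambda>(\<gamma>, t) x. g t x (path_at T \<gamma> t)) p x) \<in>
      borel_measurable ((path_measure T \<Otimes>\<^sub>M borel) \<Otimes>\<^sub>M borel)"
    using measurable_along_path[OF assms] by (simp add: case_prod_unfold)
  from nn_integral_measurable_subprob_algebra2[OF this measurable_path_kernel[OF assms(1)]]
  show ?thesis
    by (simp add: case_prod_unfold)
qed

lemma measurable_inner_integral: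
  fixes g :: "real \<Rightarrow> 'a::{metric_space, second_countable_topology} \<Rightarrow> 'a prob_measure \<Rightarrow> real"
  assumes "T \<ge> 0"
    and g: "(\<lambda>(t, x, \<mu>). g t x \<mu>) \<in> borel_measurable borel"
  shows "(\<lambda>(\<gamma>, t). \<integral>x. g t x (path_at T \<gamma> t) \<partial>the_measure (path_at T \<gamma> t))
    \<in> borel_measurable (path_measure T \<Otimes>\<^sub>M borel)"
proof -
  have "(\<lambda>(p, x). (\<lambda>(\<gamma>, t) x. g t x (path_at T \<gamma> t)) p x) \<in>
      borel_measurable ((path_measure T \<Otimes>\<^sub>M borel) \<Otimes>\<^sub>M borel)"
    using measurable_along_path[OF assms] by (simp add: case_prod_unfold)
  from integral_measurable_kernel[OF this measurable_path_kernel[OF assms(1)]]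
  show ?thesis
    by (simp add: case_prod_unfold)
qed

lemma measurable_path_nn_integral:
  fixes g :: "real \<Rightarrow> 'a::{metric_space, second_countable_topology} \<Rightarrow> 'a prob_measure \<Rightarrow> ennreal"
  assumes "T \<ge> 0"
    and "(\<lambda>(t, x, \<mu>). g t x \<mu>) \<in> borel_measurable borel"
  shows "(\<lambda>\<gamma>. \<integral>\<^sup>+t\<in>{0..T}. (\<integral>\<^sup>+x. g t x (path_at T \<gamma> t) \<partial>the_measure (path_at T \<gamma> t)) \<partial>lborel)
    \<in> borel_measurable (path_measure T)"
proof -
  note [measurable] = measurable_inner_nn_integral[OF assms]
  show ?thesis
    by measurable
qed

lemma measurable_path_integral:
  fixes g :: "real \<Rightarrow> 'a::{metric_space, second_countable_topology} \<Rightarrow> 'a prob_measure \<Rightarrow> real"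
  assumes "T \<ge> 0"
    and "(\<lambda>(t, x, \<mu>). g t x \<mu>) \<in> borel_measurable borel"
    and [measurable]: "\<xi> \<in> borel_measurable borel"
  shows "(\<lambda>\<gamma>. \<integral>t\<in>{0..T}. \<xi> t * (\<integral>x. g t x (path_at T \<gamma> t) \<partial>the_measure (path_at T \<gamma> t)) \<partial>lborel)
    \<in> borel_measurable (path_measure T)"
proof -
  note [measurable] = measurable_inner_integral[OF assms(1,2)]
  show ?thesis
    unfolding set_lebesgue_integral_def by measurable
qed

subsection \<open>Countable families of test functions\<close>

text \<open>The members of \<open>I\<close> are classified by countably many codes: finite sets of pairs \<open>(A, B)\<close> of
  basic open sets such that the sets \<open>A\<close> cover \<open>K\<close> and \<open>J i\<close> maps \<open>A\<close> into \<open>B\<close>. One representative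
  per code suffices.\<close>

lemma countable_uniformly_dense:
  fixes J :: "'i \<Rightarrow> 'a::second_countable_topology \<Rightarrow> 'b::{metric_space, second_countable_topology}"
  assumes "compact K" and J: "\<And>i. i \<in> I \<Longrightarrow> continuous_on K (J i)"
  obtains D where "D \<subseteq> I" "countable D"
    "\<And>i e. i \<in> I \<Longrightarrow> e > 0 \<Longrightarrow> \<exists>j\<in>D. \<forall>x\<in>K. dist (J j x) (J i x) < e"
proof -
  obtain \<A> :: "'a set set" where \<A>: "countable \<A>" "topological_basis \<A>"
    using ex_countable_basis by blast
  obtain \<B> :: "'b set set" where \<B>: "countable \<B>" "topological_basis \<B>"
    using ex_countable_basis by blast
  define P where "P c i \<longleftrightarrow> i \<in> I \<and> K \<subseteq> \<Union>(fst ` c) \<and> (\<forall>(A, B)\<in>c. J i ` (K \<inter> A) \<subseteq> B)" for c i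
  define C where "C = {c. finite c \<and> c \<subseteq> \<A> \<times> \<B>}"
  have "countable C"
    unfolding C_def by (intro countable_Collect_finite_subset countable_SIGMA \<A>(1) \<B>(1))
  define D where "D = (\<lambda>c. SOME i. P c i) ` {c \<in> C. \<exists>i. P c i}"
  have P_some: "P c (SOME i. P c i)" if "P c i" for c i
    using that by (rule someI)
  have "D \<subseteq> I"
    using P_some unfolding D_def P_def by blast
  moreover have "countable D"
    unfolding D_def by (intro countable_image countable_subset[OF _ \<open>countable C\<close>]) blast
  moreover have "\<exists>j\<in>D. \<forall>x\<in>K. dist (J j x) (J i x) < e" if i: "i \<in> I" and "e > 0" for i e
  proof -
    have "\<exists>A B. A \<in> \<A> \<and> B \<in> \<B> \<and> x \<in> A \<and> J i ` (K \<inter> A) \<subseteq> B \<and> B \<subseteq> ball (J i x) (e / 2)"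
      if x: "x \<in> K" for x
    proof -
      obtain B where B: "B \<in> \<B>" "J i x \<in> B" "B \<subseteq> ball (J i x) (e / 2)"
        using topological_basisE[OF \<B>(2), of "ball (J i x) (e / 2)" "J i x"] \<open>e > 0\<close> by auto
      have "open B"
        using \<B>(2) B(1) by (rule topological_basis_open)
      then obtain A where A: "open A" "x \<in> A" "\<forall>y\<in>K. y \<in> A \<longrightarrow> J i y \<in> B"
        using J[OF i, unfolded continuous_on_topological, rule_format, OF x _ B(2)] by blast
      obtain A' where "A' \<in> \<A>" "x \<in> A'" "A' \<subseteq> A"
        using topological_basisE[OF \<A>(2) A(1,2)] by blast
      then show ?thesis
        using A B by blast
    qed
    then obtain fA fB where f: "\<And>x. x \<in> K \<Longrightarrow> fA x \<in> \<A> \<and> fB x \<in> \<B> \<and> x \<in> fA x \<and>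
        J i ` (K \<inter> fA x) \<subseteq> fB x \<and> fB x \<subseteq> ball (J i x) (e / 2)"
      by metis
    obtain K' where K': "K' \<subseteq> K" "finite K'" "K \<subseteq> (\<Union>x\<in>K'. fA x)"
      using f \<open>compact K\<close> topological_basis_open[OF \<A>(2)]
      by (elim compactE_image[of K K fA]) blast+
    \<comment> \<open>A finite subcover yields a code for \<open>i\<close>. Its representative
      \<open>j\<close> may differ from \<open>i\<close>, but both map a point of \<open>fA y\<close>
      into a ball of radius \<open>e / 2\<close> around \<open>J i y\<close>, so they are within
      \<open>e\<close> of each other.\<close>
    define c where "c = (\<lambda>x. (fA x, fB x)) ` K'"
    have "P c i"
      using K' f i by (auto simp: P_def c_def) blast+
    have "c \<in> C"
      using K' f by (auto simp: C_def c_def)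
    define j where "j = (SOME i. P c i)"
    have "P c j"
      unfolding j_def using \<open>P c i\<close> by (rule P_some)
    have "j \<in> D"
      unfolding D_def j_def using \<open>c \<in> C\<close> \<open>P c i\<close> by blast
    moreover have "dist (J j x) (J i x) < e" if "x \<in> K" for x
    proof -
      obtain y where y: "y \<in> K'" "x \<in> fA y"
        using K' \<open>x \<in> K\<close> by blast
      then have "J l x \<in> fB y" if "P c l" for l
        using that \<open>x \<in> K\<close> unfolding P_def c_def by fast
      from this[OF \<open>P c j\<close>] this[OF \<open>P c i\<close>]
      have "dist (J i y) (J j x) < e / 2" "dist (J i y) (J i x) < e / 2"
        using f[of y] y(1) K'(1) by (auto simp: subset_eq)
      then show ?thesis
        using dist_triangle3[of "J j x" "J i x" "J i y"] by simp
    qed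
    ultimately show ?thesis by blast
  qed
  ultimately show ?thesis using that by blast
qed

text \<open>Density is recast as what dominated convergence consumes: pointwise convergent sequences
  with a uniform bound.\<close>

lemma countable_boundedly_dense:
  fixes J :: "'i \<Rightarrow> 'a::second_countable_topology \<Rightarrow> 'b::{real_normed_vector, second_countable_topology}"
  assumes "compact K" and J: "\<And>i. i \<in> I \<Longrightarrow> continuous_on K (J i)"
  obtains D where "D \<subseteq> I" "countable D"
    "\<And>i. i \<in> I \<Longrightarrow> \<exists>s B. range s \<subseteq> D \<and> (\<forall>x\<in>K. (\<lambda>k. J (s k) x) \<longlonglongrightarrow> J i x) \<and>
       (\<forall>k. \<forall>x\<in>K. norm (J (s k) x) \<le> B)"
proof -
  obtain D where D: "D \<subseteq> I" "countable D"
    "\<And>i e. i \<in> I \<Longrightarrow> e > 0 \<Longrightarrow> \<exists>j\<in>D. \<forall>x\<in>K. dist (J j x) (J i x) < e"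
    using countable_uniformly_dense[of K I J] assms by blast
  have "\<exists>s B. range s \<subseteq> D \<and> (\<forall>x\<in>K. (\<lambda>k. J (s k) x) \<longlonglongrightarrow> J i x) \<and>
       (\<forall>k. \<forall>x\<in>K. norm (J (s k) x) \<le> B)" if "i \<in> I" for i
  proof -
    have "\<exists>j. j \<in> D \<and> (\<forall>x\<in>K. dist (J j x) (J i x) < 1 / real (Suc k))" for k
      using D(3)[OF that, of "1 / real (Suc k)"] by auto
    then obtain s where s: "s k \<in> D" "\<And>x. x \<in> K \<Longrightarrow> dist (J (s k) x) (J i x) < 1 / real (Suc k)" for k
      by metis
    have "bounded (J i ` K)"
      using J[OF that] \<open>compact K\<close> by (intro compact_imp_bounded compact_continuous_image)
    then obtain B where B: "\<And>x. x \<in> K \<Longrightarrow> norm (J i x) \<le> B"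
      by (auto simp: bounded_iff)
    have "norm (J (s k) x) \<le> B + 1" if "x \<in> K" for k x
    proof -
      have "1 / real (Suc k) \<le> 1" by simp
      then have "norm (J (s k) x - J i x) \<le> 1"
        using s(2)[OF that, of k] unfolding dist_norm by linarith
      then show ?thesis
        using B[OF that] norm_triangle_sub[of "J (s k) x" "J i x"] by simp
    qed
    moreover have "(\<lambda>k. J (s k) x) \<longlonglongrightarrow> J i x" if "x \<in> K" for x
    proof -
      have "(\<lambda>k. dist (J (s k) x) (J i x)) \<longlonglongrightarrow> 0"
        using s(2)[OF that] by (intro real_tendsto_sandwich[OF _ _ tendsto_const LIMSEQ_inverse_real_of_nat])
          (auto simp: inverse_eq_divide intro!: always_eventually less_imp_le simp del: of_nat_Suc)
      then show ?thesis
        by (rule tendsto_dist_iff[THEN iffD2])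
    qed
    moreover have "range s \<subseteq> D"
      using s(1) by blast
    ultimately show ?thesis
      by blast
  qed
  with D(1,2) show ?thesis by (rule that)
qed

section \<open>Jets of test functions and countable dense families\<close>

text \<open>Uniform approximation of jets is approximation in the C^2 norm, so applying the density
  lemma to the continuous map \<open>jet \<phi>\<close> controls the function and both derivatives
  together.\<close>

definition jet :: "(real^'n \<Rightarrow> real) \<Rightarrow> real^'n \<Rightarrow> real \<times> (real^'n) \<times> (real^'n^'n)" where
  "jet \<phi> x = (\<phi> x, grad \<phi> x, hessian \<phi> x)"

lemma C2c_continuous:
  assumes "\<phi> \<in> C2c"
  shows "continuous_on A \<phi>" "continuous_on A (grad \<phi>)" "continuous_on A (hessian \<phi>)"
    "continuous_on A (jet \<phi>)"
proof -
  have "continuous_on UNIV \<phi>" "continuous_on UNIV (grad \<phi>)" "continuous_on UNIV (hessian \<phi>)"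
    using assms by (auto simp: C2c_def intro!: differentiable_imp_continuous_on differentiable_on_subset
      differentiable_at_imp_differentiable_on)
  then show "continuous_on A \<phi>" "continuous_on A (grad \<phi>)" "continuous_on A (hessian \<phi>)"
    by (auto intro: continuous_on_subset)
  then show "continuous_on A (jet \<phi>)"
    unfolding jet_def by (intro continuous_intros)
qed

lemma C2c_measurable:
  assumes "\<phi> \<in> C2c"
  shows "\<phi> \<in> borel_measurable borel" "grad \<phi> \<in> borel_measurable borel"
    "hessian \<phi> \<in> borel_measurable borel"
  using C2c_continuous[OF assms] by (auto intro: borel_measurable_continuous_onI)

text \<open>The strict inequality describes an open set, on which vanishing passes to derivatives.
  \<open>frechet_derivative\<close> is a choice, so uniqueness of the derivative is invoked twice to
  fix its value.\<close>

lemma jet_outside_support: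
  fixes \<phi> :: "real^'n \<Rightarrow> real"
  assumes "\<And>y. N < norm y \<Longrightarrow> \<phi> y = 0" and x: "N < norm x"
  shows "jet \<phi> x = 0"
proof -
  have U: "open {y :: real^'n. N < norm y}"
    by (intro open_Collect_less continuous_intros)
  have "(\<phi> has_derivative (\<lambda>_. 0)) (at y)" if "N < norm y" for y
    using that assms(1)
    by (intro has_derivative_transform_within_open[OF has_derivative_const[of 0] U]) auto
  then have "frechet_derivative \<phi> (at y) = (\<lambda>_. 0)" if "N < norm y" for y
    using that by (metis frechet_derivative_at)
  then have grad: "grad \<phi> y = 0" if "N < norm y" for y
    using that by (simp add: grad_def vec_eq_iff)
  have "(grad \<phi> has_derivative (\<lambda>_. 0)) (at x)"
    using x grad
    by (intro has_derivative_transform_within_open[OF has_derivative_const[of 0] U]) auto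
  then have "frechet_derivative (grad \<phi>) (at x) = (\<lambda>_. 0)"
    by (metis frechet_derivative_at)
  then have "hessian \<phi> x = 0"
    by (simp add: hessian_def jacobian_def matrix_def vec_eq_iff)
  then show ?thesis
    using assms(1)[OF x] grad[OF x] by (simp add: jet_def zero_prod_def)
qed

text \<open>Test functions supported in the ball of radius \<open>n\<close> are approximated within
  their own class, and the countable families are united over \<open>n\<close>. All approximants of
  one function thus vanish off the same ball, where convergence and bound become trivial.\<close>

lemma C2c_countably_dense:
  obtains D :: "(real^'n \<Rightarrow> real) set" where "D \<subseteq> C2c" "countable D"
    "\<And>\<phi>. \<phi> \<in> C2c \<Longrightarrow> \<exists>s B N. range s \<subseteq> D \<and> (\<forall>x. (\<lambda>k. jet (s k) x) \<longlonglongrightarrow> jet \<phi> x) \<and>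
       (\<forall>k x. norm (jet (s k) x) \<le> B) \<and> 0 \<le> N \<and> (\<forall>k x. N < norm x \<longrightarrow> jet (s k) x = 0)"
proof -
  define I where "I n = {\<phi> \<in> C2c. \<forall>x :: real^'n. real n < norm x \<longrightarrow> \<phi> x = 0}" for n
  have "\<exists>D. D \<subseteq> I n \<and> countable D \<and> (\<forall>\<phi>\<in>I n. \<exists>s B. range s \<subseteq> D \<and>
       (\<forall>x\<in>cball 0 (real n). (\<lambda>k. jet (s k) x) \<longlonglongrightarrow> jet \<phi> x) \<and>
       (\<forall>k. \<forall>x\<in>cball 0 (real n). norm (jet (s k) x) \<le> B))" for n
  proof -
    have "continuous_on (cball 0 (real n)) (jet \<phi>)" if "\<phi> \<in> I n" for \<phi>
      using that by (simp add: I_def C2c_continuous(4))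
    from countable_boundedly_dense[of "cball 0 (real n)" "I n" jet, OF compact_cball this]
    show ?thesis by metis
  qed
  then obtain D where D: "\<And>n. D n \<subseteq> I n" "\<And>n. countable (D n)"
    "\<And>n \<phi>. \<phi> \<in> I n \<Longrightarrow> \<exists>s B. range s \<subseteq> D n \<and>
       (\<forall>x\<in>cball 0 (real n). (\<lambda>k. jet (s k) x) \<longlonglongrightarrow> jet \<phi> x) \<and>
       (\<forall>k. \<forall>x\<in>cball 0 (real n). norm (jet (s k) x) \<le> B)"
    by metis
  show ?thesis
  proof
    show "(\<Union>n. D n) \<subseteq> C2c"
      using D(1) unfolding I_def by blast
    show "countable (\<Union>n. D n)"
      by (intro countable_UN countableI_type D(2))
    fix \<phi> :: "real^'n \<Rightarrow> real"
    assume "\<phi> \<in> C2c"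
    then have "bounded (closure {x. \<phi> x \<noteq> 0})"
      by (simp add: C2c_def compact_imp_bounded)
    then have "bounded {x. \<phi> x \<noteq> 0}"
      using closure_subset by (rule bounded_subset)
    then obtain R where R: "\<And>x. \<phi> x \<noteq> 0 \<Longrightarrow> norm x \<le> R"
      unfolding bounded_iff by blast
    obtain n :: nat where "R \<le> real n"
      using real_arch_simple by blast
    have n: "\<phi> \<in> I n"
      using \<open>\<phi> \<in> C2c\<close> R \<open>R \<le> real n\<close> unfolding I_def by force
    have zero: "jet \<psi> x = 0" if "\<psi> \<in> I n" "real n < norm x" for \<psi> x
      using that by (intro jet_outside_support[of "real n"]) (auto simp: I_def)
    obtain s B where s: "range s \<subseteq> D n"
      "\<And>x. x \<in> cball 0 (real n) \<Longrightarrow> (\<lambda>k. jet (s k) x) \<longlonglongrightarrow> jet \<phi> x"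
      "\<And>k x. x \<in> cball 0 (real n) \<Longrightarrow> norm (jet (s k) x) \<le> B"
      using D(3)[OF n] by blast
    have sI: "s k \<in> I n" for k
      using s(1) D(1) by blast
    have "(\<lambda>k. jet (s k) x) \<longlonglongrightarrow> jet \<phi> x" for x
    proof (cases "real n < norm x")
      case True
      then show ?thesis by (simp only: zero[OF sI] zero[OF n] tendsto_const)
    qed (simp add: s(2))
    moreover have "norm (jet (s k) x) \<le> \<bar>B\<bar>" for k x
    proof (cases "real n < norm x")
      case True
      then show ?thesis by (simp only: zero[OF sI] norm_zero abs_ge_zero)
    next
      case False
      then have "norm (jet (s k) x) \<le> B" by (intro s(3)) simp
      then show ?thesis by simp
    qed
    moreover have "range s \<subseteq> (\<Union>n. D n)"
      using s(1) by blast
    ultimately show "\<exists>s B N. range s \<subseteq> (\<Union>n. D n) \<and> (\<forall>x. (\<lambda>k. jet (s k) x) \<longlonglongrightarrow> jet \<phi> x) \<and>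
       (\<forall>k x. norm (jet (s k) x) \<le> B) \<and> 0 \<le> N \<and> (\<forall>k x. N < norm x \<longrightarrow> jet (s k) x = 0)"
      using zero[OF sI] by (intro exI[of _ s] exI[of _ "\<bar>B\<bar>"] exI[of _ "real n"] conjI allI impI of_nat_0_le_iff)
  qed
qed

lemma C1c_continuous:
  assumes "\<xi> \<in> C1c T"
  shows "continuous_on A \<xi>" "continuous_on A (deriv \<xi>)"
proof -
  obtain D where D: "\<And>t. (\<xi> has_vector_derivative D t) (at t)" "continuous_on UNIV D"
    using assms by (auto simp: C1c_def C1_differentiable_on_def)
  have "deriv \<xi> = D"
    using D(1) by (auto simp: fun_eq_iff has_real_derivative_iff_has_vector_derivative intro!: DERIV_imp_deriv)
  then show "continuous_on A (deriv \<xi>)"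
    using D(2) continuous_on_subset by blast
  have "isCont \<xi> t" for t
    using D(1)[of t] by (rule has_vector_derivative_continuous)
  then show "continuous_on A \<xi>"
    by (simp add: continuous_at_imp_continuous_on)
qed

lemma C1c_measurable:
  assumes "\<xi> \<in> C1c T"
  shows "\<xi> \<in> borel_measurable borel" "deriv \<xi> \<in> borel_measurable borel"
  using C1c_continuous[OF assms] by (auto intro: borel_measurable_continuous_onI)

text \<open>The time integrals run over [0,T], so control of the function and its derivative on this
  compact interval is enough.\<close>

lemma C1c_countably_dense:
  obtains D where "D \<subseteq> C1c T" "countable D"
    "\<And>\<xi>. \<xi> \<in> C1c T \<Longrightarrow> \<exists>s B. range s \<subseteq> D \<and>
       (\<forall>t\<in>{0..T}. (\<lambda>k. (s k t, deriv (s k) t)) \<longlonglongrightarrow> (\<xi> t, deriv \<xi> t)) \<and>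
       (\<forall>k. \<forall>t\<in>{0..T}. norm (s k t, deriv (s k) t) \<le> B)"
  by (rule countable_boundedly_dense[of "{0..T}" "C1c T" "\<lambda>\<xi> t. (\<xi> t, deriv \<xi> t)"])
    (auto intro: continuous_on_Pair C1c_continuous)

subsection \<open>The weak equation\<close>

lemma frobenius_eq_inner: "A :\<^sub>F B = A \<bullet> B"
  by (simp add: frobenius_def inner_vec_def)

definition KFP_weight ::
  "(real \<Rightarrow> real^'n \<Rightarrow> (real^'n) prob_measure \<Rightarrow> real^'n) \<Rightarrow>
   (real \<Rightarrow> real^'n \<Rightarrow> (real^'n) prob_measure \<Rightarrow> real^'n^'n) \<Rightarrow>
   real \<Rightarrow> real^'n \<Rightarrow> (real^'n) prob_measure \<Rightarrow> real" where
  "KFP_weight b a t x \<nu> =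
     norm (b t x \<nu>) / (1 + norm x) + norm (a t x \<nu>) / (1 + (norm x)\<^sup>2)"

lemma KFP_weight_nonneg: "0 \<le> KFP_weight b a t x \<nu>"
  by (simp add: KFP_weight_def)

text \<open>On the ball of radius \<open>N\<close> both \<open>1 + norm x\<close> and
  \<open>1 + (norm x)\<^sup>2\<close> are at most \<open>(1 + N)\<^sup>2\<close>, so this factor
  undoes the decay of the weight; off the ball the operator vanishes. The energy density thereby
  dominates the operator on all test functions of one approximating sequence.\<close>

lemma KFP_operator_bound:
  fixes \<phi> :: "real^'n \<Rightarrow> real"
  assumes B: "norm (jet \<phi> x) \<le> B" and N: "0 \<le> N" "N < norm x \<Longrightarrow> jet \<phi> x = 0"
  shows "\<bar>KFP_operator b a \<mu> t \<phi> x\<bar> \<le> B * (1 + N)\<^sup>2 * KFP_weight b a t x (\<mu> t)"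
proof (cases "N < norm x")
  case True
  then have "grad \<phi> x = 0" "hessian \<phi> x = 0"
    using N(2) by (auto simp: jet_def zero_prod_def)
  moreover have "0 \<le> B"
    using B norm_ge_zero order_trans by blast
  ultimately show ?thesis
    using KFP_weight_nonneg[of b a t x "\<mu> t"] by (simp add: KFP_operator_def frobenius_eq_inner)
next
  case False
  have "0 \<le> B"
    using B norm_ge_zero order_trans by blast
  have grad: "norm (grad \<phi> x) \<le> B"
    using B norm_fst_le[of "grad \<phi> x" "hessian \<phi> x"] norm_snd_le[of "(grad \<phi> x, hessian \<phi> x)" "\<phi> x"]
    by (simp add: jet_def)
  have hess: "norm (hessian \<phi> x) \<le> B"
    using B norm_snd_le[of "hessian \<phi> x" "grad \<phi> x"] norm_snd_le[of "(grad \<phi> x, hessian \<phi> x)" "\<phi> x"]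
    by (simp add: jet_def)
  have "1 + norm x \<le> (1 + N)\<^sup>2"
    using False N(1) by (auto simp: power2_eq_square algebra_simps intro: add_nonneg_nonneg)
      (smt (verit) mult_nonneg_nonneg)
  moreover have "1 + (norm x)\<^sup>2 \<le> (1 + N)\<^sup>2"
  proof -
    have "(norm x)\<^sup>2 \<le> N\<^sup>2"
      using False by (intro power_mono) auto
    moreover have "(1 + N)\<^sup>2 = 1 + 2 * N + N\<^sup>2"
      by (simp add: power2_sum)
    ultimately show ?thesis
      using N(1) by linarith
  qed
  ultimately have *: "B \<le> B * (1 + N)\<^sup>2 / (1 + norm x)" "B \<le> B * (1 + N)\<^sup>2 / (1 + (norm x)\<^sup>2)"
    using \<open>0 \<le> B\<close> by (auto simp: pos_le_divide_eq add_pos_nonneg intro: mult_left_mono)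
  have "\<bar>b t x (\<mu> t) \<bullet> grad \<phi> x\<bar> \<le> norm (b t x (\<mu> t)) * (B * (1 + N)\<^sup>2 / (1 + norm x))"
    using grad *(1) by (intro order_trans[OF Cauchy_Schwarz_ineq2] mult_left_mono) auto
  moreover have "\<bar>a t x (\<mu> t) \<bullet> hessian \<phi> x\<bar> \<le> norm (a t x (\<mu> t)) * (B * (1 + N)\<^sup>2 / (1 + (norm x)\<^sup>2))"
    using hess *(2) by (intro order_trans[OF Cauchy_Schwarz_ineq2] mult_left_mono) auto
  ultimately have "\<bar>KFP_operator b a \<mu> t \<phi> x\<bar> \<le> norm (b t x (\<mu> t)) * (B * (1 + N)\<^sup>2 / (1 + norm x))
      + norm (a t x (\<mu> t)) * (B * (1 + N)\<^sup>2 / (1 + (norm x)\<^sup>2))"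
    unfolding KFP_operator_def frobenius_eq_inner by (simp add: abs_if split: if_splits)
  also have "\<dots> = B * (1 + N)\<^sup>2 * KFP_weight b a t x (\<mu> t)"
    by (simp add: KFP_weight_def algebra_simps)
  finally show ?thesis .
qed

lemma measurable_frozen_arguments:
  assumes "(\<lambda>(t, x, \<mu>). g t x \<mu>) \<in> borel_measurable borel"
  shows "(\<lambda>x. g t x \<mu>) \<in> borel_measurable borel"
proof -
  have "(\<lambda>x. (t, x, \<mu>)) \<in> borel_measurable borel"
    by (intro borel_measurable_continuous_onI continuous_intros)
  from measurable_compose[OF this assms] show ?thesis
    by simp
qed

lemma pred_Ball_countable:
  assumes "countable I" and P: "\<And>i. i \<in> I \<Longrightarrow> Measurable.pred M (P i)"
  shows "Measurable.pred M (\<lambda>x. \<forall>i\<in>I. P i x)"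
proof -
  have "(\<Union>i\<in>I. {x \<in> space M. \<not> P i x}) \<in> sets M"
  proof (rule sets.countable_UN'[OF \<open>countable I\<close>])
    show "(\<lambda>i. {x \<in> space M. \<not> P i x}) ` I \<subseteq> sets M"
      using P by (auto simp: pred_def[symmetric] intro!: pred_intros_logic)
  qed
  then have "space M - (\<Union>i\<in>I. {x \<in> space M. \<not> P i x}) \<in> sets M"
    by (rule sets.compl_sets)
  also have "space M - (\<Union>i\<in>I. {x \<in> space M. \<not> P i x}) = {x \<in> space M. \<forall>i\<in>I. P i x}"
    by auto
  finally show ?thesis
    by (simp add: pred_def)
qed

text \<open>Measurability is demanded for all real times, so that the integrands along clamped paths
  are jointly measurable. Coefficients given on [0,T] enter through their extension by zero.\<close>

locale KFP_coefficients =
  fixes T :: real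
    and b :: "real \<Rightarrow> real^'n \<Rightarrow> (real^'n) prob_measure \<Rightarrow> real^'n"
    and a :: "real \<Rightarrow> real^'n \<Rightarrow> (real^'n) prob_measure \<Rightarrow> real^'n^'n"
  assumes T: "T \<ge> 0"
    and b: "(\<lambda>(t, x, \<mu>). b t x \<mu>) \<in> borel_measurable borel"
    and a: "(\<lambda>(t, x, \<mu>). a t x \<mu>) \<in> borel_measurable borel"
begin

lemma measurable_KFP_weight:
  "(\<lambda>(t, x, \<nu>). KFP_weight b a t x \<nu>) \<in> borel_measurable borel"
proof -
  note [measurable] = b[unfolded case_prod_unfold] a[unfolded case_prod_unfold]
  have [measurable]: "(\<lambda>p :: real \<times> (real^'n) \<times> (real^'n) prob_measure. fst (snd p)) \<in> borel_measurable borel"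
    by (intro borel_measurable_continuous_onI continuous_intros)
  show ?thesis
    unfolding KFP_weight_def case_prod_unfold by measurable
qed

text \<open>The operator sees its path only through the value at time \<open>t\<close>. A constant
  path therefore turns it into a function of \<open>(t, x, \<nu>)\<close>, the form required for
  substituting a path later.\<close>

lemma measurable_KFP_operator:
  assumes "\<phi> \<in> C2c"
  shows "(\<lambda>(t, x, \<nu>). KFP_operator b a (\<lambda>_. \<nu>) t \<phi> x) \<in> borel_measurable borel"
proof -
  note [measurable] = b[unfolded case_prod_unfold] a[unfolded case_prod_unfold] C2c_measurable[OF assms]
  have [measurable]: "(\<lambda>p :: real \<times> (real^'n) \<times> (real^'n) prob_measure. fst (snd p)) \<in> borel_measurable borel"
    by (intro borel_measurable_continuous_onI continuous_intros)
  show ?thesis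
    unfolding KFP_operator_def frobenius_eq_inner case_prod_unfold by measurable
qed

definition energy :: "(real \<Rightarrow> (real^'n) prob_measure) \<Rightarrow> ennreal" where
  "energy \<gamma> = (\<integral>\<^sup>+t\<in>{0..T}. (\<integral>\<^sup>+x. KFP_weight b a t x (path_at T \<gamma> t)
      \<partial>the_measure (path_at T \<gamma> t)) \<partial>lborel)"

definition weak_lhs :: "(real \<Rightarrow> real) \<Rightarrow> (real^'n \<Rightarrow> real) \<Rightarrow> (real \<Rightarrow> (real^'n) prob_measure) \<Rightarrow> real" where
  "weak_lhs \<xi> \<phi> \<gamma> =
     (\<integral>t\<in>{0..T}. deriv \<xi> t * (\<integral>x. \<phi> x \<partial>the_measure (path_at T \<gamma> t)) \<partial>lborel)"

definition weak_rhs :: "(real \<Rightarrow> real) \<Rightarrow> (real^'n \<Rightarrow> real) \<Rightarrow> (real \<Rightarrow> (real^'n) prob_measure) \<Rightarrow> real" where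
  "weak_rhs \<xi> \<phi> \<gamma> =
     (\<integral>t\<in>{0..T}. \<xi> t * (\<integral>x. KFP_operator b a (path_at T \<gamma>) t \<phi> x \<partial>the_measure (path_at T \<gamma> t)) \<partial>lborel)"

lemma KFP_eq:
  "KFP T b a = {\<gamma> \<in> cont_paths T. energy \<gamma> < \<infinity> \<and>
     (\<forall>\<xi>\<in>C1c T. \<forall>\<phi>\<in>C2c. weak_lhs \<xi> \<phi> \<gamma> = - weak_rhs \<xi> \<phi> \<gamma>)}"
proof -
  have "energy \<gamma> = (\<integral>\<^sup>+t\<in>{0..T}. (\<integral>\<^sup>+x. ennreal (norm (b t x (\<gamma> t)) / (1 + norm x)
          + norm (a t x (\<gamma> t)) / (1 + (norm x)\<^sup>2)) \<partial>the_measure (\<gamma> t)) \<partial>lborel)" for \<gamma>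
    unfolding energy_def KFP_weight_def
    by (intro nn_integral_cong) (auto split: split_indicator)
  moreover have "weak_lhs \<xi> \<phi> \<gamma> =
      (\<integral>t\<in>{0..T}. deriv \<xi> t * (\<integral>x. \<phi> x \<partial>the_measure (\<gamma> t)) \<partial>lborel)" for \<xi> \<phi> \<gamma>
    unfolding weak_lhs_def set_lebesgue_integral_def
    by (intro Bochner_Integration.integral_cong) (auto split: split_indicator)
  moreover have "weak_rhs \<xi> \<phi> \<gamma> =
      (\<integral>t\<in>{0..T}. \<xi> t * (\<integral>x. KFP_operator b a \<gamma> t \<phi> x \<partial>the_measure (\<gamma> t)) \<partial>lborel)" for \<xi> \<phi> \<gamma>
    unfolding weak_rhs_def set_lebesgue_integral_def KFP_operator_def
    by (intro Bochner_Integration.integral_cong) (auto split: split_indicator)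
  ultimately show ?thesis
    unfolding KFP_def by simp
qed

lemma measurable_energy: "energy \<in> borel_measurable (path_measure T)"
proof -
  have "(\<lambda>(t, x, \<nu>). ennreal (KFP_weight b a t x \<nu>)) \<in> borel_measurable borel"
    using measurable_compose[OF measurable_KFP_weight measurable_ennreal] by (simp add: case_prod_unfold)
  from measurable_path_nn_integral[OF T this] show ?thesis
    unfolding energy_def .
qed

lemma measurable_weak_lhs:
  assumes "\<xi> \<in> C1c T" "\<phi> \<in> C2c"
  shows "weak_lhs \<xi> \<phi> \<in> borel_measurable (path_measure T)"
proof -
  have "(\<lambda>p :: real \<times> (real^'n) \<times> (real^'n) prob_measure. fst (snd p)) \<in> borel_measurable borel"
    by (intro borel_measurable_continuous_onI continuous_intros)
  from measurable_compose[OF this C2c_measurable(1)[OF assms(2)]]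
  have "(\<lambda>(t :: real, x, \<nu> :: (real^'n) prob_measure). \<phi> x) \<in> borel_measurable borel"
    by (simp add: case_prod_unfold)
  from measurable_path_integral[OF T this C1c_measurable(2)[OF assms(1)]] show ?thesis
    unfolding weak_lhs_def .
qed

lemma measurable_weak_rhs:
  assumes "\<xi> \<in> C1c T" "\<phi> \<in> C2c"
  shows "weak_rhs \<xi> \<phi> \<in> borel_measurable (path_measure T)"
  using measurable_path_integral[OF T measurable_KFP_operator[OF assms(2)] C1c_measurable(1)[OF assms(1)]]
  unfolding weak_rhs_def KFP_operator_def .

section \<open>Limits in the weak equation along a fixed path\<close>

lemma measurable_slice:
  assumes "\<gamma> \<in> cont_paths T"
    and "(\<lambda>(\<gamma>, t). f \<gamma> t) \<in> path_measure T \<Otimes>\<^sub>M borel \<rightarrow>\<^sub>M N"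
  shows "(\<lambda>t. f \<gamma> t) \<in> borel \<rightarrow>\<^sub>M N"
proof -
  have "(\<lambda>t. (\<gamma>, t)) \<in> borel \<rightarrow>\<^sub>M path_measure T \<Otimes>\<^sub>M borel"
    using assms(1) by (intro measurable_Pair1') simp
  from measurable_compose[OF this assms(2)] show ?thesis
    by simp
qed

text \<open>Dominated convergence is used twice: in space with the constant \<open>B\<close>,
  integrable for a probability measure, and in time with \<open>A * B\<close> on [0,T].\<close>

lemma tendsto_weak_lhs:
  assumes \<gamma>: "\<gamma> \<in> cont_paths T"
    and \<xi>: "\<And>k. \<xi> k \<in> C1c T" "\<xi>' \<in> C1c T"
      "\<And>t. t \<in> {0..T} \<Longrightarrow> (\<lambda>k. deriv (\<xi> k) t) \<longlonglongrightarrow> deriv \<xi>' t"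
      "\<And>k t. t \<in> {0..T} \<Longrightarrow> \<bar>deriv (\<xi> k) t\<bar> \<le> A"
    and \<phi>: "\<And>k. \<phi> k \<in> C2c" "\<phi>' \<in> C2c" "\<And>x. (\<lambda>k. \<phi> k x) \<longlonglongrightarrow> \<phi>' x" "\<And>k x. \<bar>\<phi> k x\<bar> \<le> B"
  shows "(\<lambda>k. weak_lhs (\<xi> k) (\<phi> k) \<gamma>) \<longlonglongrightarrow> weak_lhs \<xi>' \<phi>' \<gamma>"
proof -
  define m where "m t = the_measure (path_at T \<gamma> t)" for t
  have m: "prob_space (m t)" "finite_measure (m t)" "measurable (m t) borel = borel_measurable borel"
    for t by (simp_all add: m_def)
  have [measurable]: "(\<lambda>t. \<integral>x. f x \<partial>m t) \<in> borel_measurable borel"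
    if f: "f \<in> borel_measurable borel" for f :: "real^'n \<Rightarrow> real"
  proof -
    have "(\<lambda>p. integral\<^sup>L (case p of (\<gamma>, t) \<Rightarrow> the_measure (path_at T \<gamma> t)) f)
        \<in> borel_measurable (path_measure T \<Otimes>\<^sub>M borel)"
      by (rule measurable_compose[OF measurable_path_kernel[OF T] integral_measurable_subprob_algebra[OF f]])
    then show ?thesis
      unfolding m_def using \<gamma> by (intro measurable_slice[where f = "\<lambda>\<gamma> t. \<integral>x. f x \<partial>the_measure (path_at T \<gamma> t)"])
        (auto simp: case_prod_unfold)
  qed
  note [measurable] = C2c_measurable(1)[OF \<phi>(1)] C2c_measurable(1)[OF \<phi>(2)]
    C1c_measurable(2)[OF \<xi>(1)] C1c_measurable(2)[OF \<xi>(2)]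
  have inner: "(\<lambda>k. \<integral>x. \<phi> k x \<partial>m t) \<longlonglongrightarrow> (\<integral>x. \<phi>' x \<partial>m t)" for t
  proof (rule integral_dominated_convergence[where w = "\<lambda>_. B"])
    show "\<phi> k \<in> borel_measurable (m t)" "\<phi>' \<in> borel_measurable (m t)" for k
      unfolding m by measurable
    show "integrable (m t) (\<lambda>_. B)"
      by (rule finite_measure.integrable_const) (rule m)
  qed (use \<phi> in auto)
  have bound: "\<bar>\<integral>x. \<phi> k x \<partial>m t\<bar> \<le> B" for k t
  proof -
    have "integrable (m t) (\<phi> k)"
      using \<phi>(4) by (intro finite_measure.integrable_const_bound[OF m(2), of _ B]) (auto simp: m)
    then have "norm (\<integral>x. \<phi> k x \<partial>m t) \<le> (\<integral>x. B \<partial>m t)"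
      using \<phi>(4) by (intro Bochner_Integration.integral_norm_bound_integral finite_measure.integrable_const m(2)) auto
    also have "\<dots> = B"
      using prob_space.prob_space[OF m(1)[of t]] by simp
    finally show ?thesis by simp
  qed
  have "0 \<le> B"
    using \<phi>(4)[of 0 undefined] by simp
  show ?thesis
    unfolding weak_lhs_def set_lebesgue_integral_def m_def[symmetric]
  proof (rule integral_dominated_convergence[where w = "\<lambda>t. indicator {0..T} t *\<^sub>R (A * B)"])
    show "integrable lborel (\<lambda>t. indicator {0..T} t *\<^sub>R (A * B))"
      by (intro integrable_scaleR_left) (auto simp: T integrable_indicator_iff)
    show "AE t in lborel. (\<lambda>k. indicator {0..T} t *\<^sub>R (deriv (\<xi> k) t * (\<integral>x. \<phi> k x \<partial>m t)))
        \<longlonglongrightarrow> indicator {0..T} t *\<^sub>R (deriv \<xi>' t * (\<integral>x. \<phi>' x \<partial>m t))"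
      using \<xi>(3) inner by (intro AE_I2) (auto split: split_indicator intro!: tendsto_intros)
    show "AE t in lborel. norm (indicator {0..T} t *\<^sub>R (deriv (\<xi> k) t * (\<integral>x. \<phi> k x \<partial>m t)))
        \<le> indicator {0..T} t *\<^sub>R (A * B)" for k
      using \<xi>(4) bound \<open>0 \<le> B\<close>
      by (intro AE_I2) (auto split: split_indicator simp: abs_mult intro!: mult_mono intro: order_trans[OF abs_ge_zero])
  qed measurable
qed

text \<open>Finite energy makes the spatial integral of the weight finite for almost every time and
  integrable in time. It supplies the dominating function in space at those times, and then the one
  in time.\<close>

lemma tendsto_weak_rhs:
  assumes \<gamma>: "\<gamma> \<in> cont_paths T" and fin: "energy \<gamma> < \<infinity>"
    and \<xi>: "\<And>k. \<xi> k \<in> C1c T" "\<xi>' \<in> C1c T"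
      "\<And>t. t \<in> {0..T} \<Longrightarrow> (\<lambda>k. \<xi> k t) \<longlonglongrightarrow> \<xi>' t"
      "\<And>k t. t \<in> {0..T} \<Longrightarrow> \<bar>\<xi> k t\<bar> \<le> A"
    and \<phi>: "\<And>k. \<phi> k \<in> C2c" "\<phi>' \<in> C2c" "\<And>x. (\<lambda>k. jet (\<phi> k) x) \<longlonglongrightarrow> jet \<phi>' x"
      "\<And>k x. norm (jet (\<phi> k) x) \<le> B" "0 \<le> N" "\<And>k x. N < norm x \<Longrightarrow> jet (\<phi> k) x = 0"
  shows "(\<lambda>k. weak_rhs (\<xi> k) (\<phi> k) \<gamma>) \<longlonglongrightarrow> weak_rhs \<xi>' \<phi>' \<gamma>"
proof -
  define m where "m t = the_measure (path_at T \<gamma> t)" for t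
  have m: "measurable (m t) borel = borel_measurable borel" for t
    by (simp add: m_def)
  define L where "L \<phi> t x = KFP_operator b a (path_at T \<gamma>) t \<phi> x" for \<phi> t x
  define w where "w t x = KFP_weight b a t x (path_at T \<gamma> t)" for t x
  define W where "W t = (\<integral>\<^sup>+x. w t x \<partial>m t) * indicator {0..T} t" for t
  define C where "C = B * (1 + N)\<^sup>2"
  have w: "0 \<le> w t x" for t x
    unfolding w_def by (rule KFP_weight_nonneg)
  have w_meas: "w t \<in> borel_measurable borel" for t
    unfolding w_def by (rule measurable_frozen_arguments) (rule measurable_KFP_weight)
  have L_meas: "L \<psi> t \<in> borel_measurable borel" if "\<psi> \<in> C2c" for \<psi> t
    using measurable_frozen_arguments[OF measurable_KFP_operator[OF that], where t = t and \<mu> = "path_at T \<gamma> t"]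
    unfolding L_def KFP_operator_def .
  have intL_meas: "(\<lambda>t. \<integral>x. L \<psi> t x \<partial>m t) \<in> borel_measurable borel" if "\<psi> \<in> C2c" for \<psi>
    using measurable_slice[OF \<gamma> measurable_inner_integral[OF T measurable_KFP_operator[OF that]]]
    unfolding L_def KFP_operator_def m_def .
  have "(\<lambda>(t, x, \<nu>). ennreal (KFP_weight b a t x \<nu>)) \<in> borel_measurable borel"
    using measurable_compose[OF measurable_KFP_weight measurable_ennreal] by (simp add: case_prod_unfold)
  from measurable_slice[OF \<gamma> measurable_inner_nn_integral[OF T this]]
  have [measurable]: "W \<in> borel_measurable borel"
    unfolding W_def w_def m_def by simp
  have fin': "(\<integral>\<^sup>+t. W t \<partial>lborel) < \<infinity>"
    using fin unfolding energy_def W_def w_def m_def .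
  then have W_fin: "AE t in lborel. W t \<noteq> \<infinity>"
    by (intro nn_integral_noteq_infinite) auto
  \<comment> \<open>\<open>enn2real\<close> sends \<infinity> to 0, so converting to reals can only
    lower the integrand.\<close>
  have "(\<integral>\<^sup>+t. ennreal (enn2real (W t)) \<partial>lborel) \<le> (\<integral>\<^sup>+t. W t \<partial>lborel)"
    by (intro nn_integral_mono) (metis ennreal_enn2real_if order_refl zero_le)
  then have W_int: "integrable lborel (\<lambda>t. enn2real (W t))"
    using fin' by (intro integrableI_nonneg) auto
  have "0 \<le> C"
    unfolding C_def using \<phi>(4)[of 0 undefined] norm_ge_zero order_trans by (intro mult_nonneg_nonneg) (blast, simp)
  have L_bound: "norm (L (\<phi> k) t x) \<le> C * w t x" for k t x
    unfolding L_def w_def C_def real_norm_def by (rule KFP_operator_bound) (use \<phi> in auto)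
  have L_lim: "(\<lambda>k. L (\<phi> k) t x) \<longlonglongrightarrow> L \<phi>' t x" for t x
  proof -
    have "(\<lambda>k. grad (\<phi> k) x) \<longlonglongrightarrow> grad \<phi>' x" "(\<lambda>k. hessian (\<phi> k) x) \<longlonglongrightarrow> hessian \<phi>' x"
      using tendsto_fst[OF tendsto_snd[OF \<phi>(3)[of x]]] tendsto_snd[OF tendsto_snd[OF \<phi>(3)[of x]]]
      by (simp_all add: jet_def)
    then show ?thesis
      unfolding L_def KFP_operator_def frobenius_eq_inner by (intro tendsto_intros)
  qed
  have w_int: "integrable (m t) (w t)" if "t \<in> {0..T}" "W t \<noteq> \<infinity>" for t
    using that w w_meas by (intro integrableI_nonneg) (auto simp: m W_def less_top)
  have w_eq: "(\<integral>x. w t x \<partial>m t) = enn2real (W t)" if "t \<in> {0..T}" for t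
    using that w w_meas by (subst integral_eq_nn_integral) (auto simp: m W_def)
  have inner: "(\<lambda>k. \<integral>x. L (\<phi> k) t x \<partial>m t) \<longlonglongrightarrow> (\<integral>x. L \<phi>' t x \<partial>m t)"
    if "t \<in> {0..T}" "W t \<noteq> \<infinity>" for t
  proof (rule integral_dominated_convergence[where w = "\<lambda>x. C * w t x"])
    show "integrable (m t) (\<lambda>x. C * w t x)"
      using w_int[OF that] by simp
  qed (use L_meas \<phi> L_lim L_bound in \<open>auto simp: m\<close>)
  have bound: "\<bar>\<integral>x. L (\<phi> k) t x \<partial>m t\<bar> \<le> C * enn2real (W t)" if t: "t \<in> {0..T}" "W t \<noteq> \<infinity>" for k t
  proof -
    have *: "integrable (m t) (\<lambda>x. C * w t x)"
      using w_int[OF t] by simp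
    have "integrable (m t) (L (\<phi> k) t)"
      using L_meas[OF \<phi>(1)] L_bound w \<open>0 \<le> C\<close> by (intro Bochner_Integration.integrable_bound[OF *]) (auto simp: m)
    then have "norm (\<integral>x. L (\<phi> k) t x \<partial>m t) \<le> (\<integral>x. C * w t x \<partial>m t)"
      using L_bound by (intro Bochner_Integration.integral_norm_bound_integral *)
    then show ?thesis
      using w_eq[OF t(1)] by simp
  qed
  note [measurable] = intL_meas[OF \<phi>(1)] intL_meas[OF \<phi>(2)]
    C1c_measurable(1)[OF \<xi>(1)] C1c_measurable(1)[OF \<xi>(2)]
  show ?thesis
    unfolding weak_rhs_def set_lebesgue_integral_def m_def[symmetric] L_def[symmetric]
  proof (rule integral_dominated_convergence[where w = "\<lambda>t. A * (C * enn2real (W t))"])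
    show "integrable lborel (\<lambda>t. A * (C * enn2real (W t)))"
      using W_int by simp
    show "AE t in lborel. (\<lambda>k. indicator {0..T} t *\<^sub>R (\<xi> k t * (\<integral>x. L (\<phi> k) t x \<partial>m t)))
        \<longlonglongrightarrow> indicator {0..T} t *\<^sub>R (\<xi>' t * (\<integral>x. L \<phi>' t x \<partial>m t))"
      using W_fin
    proof eventually_elim
      case (elim t)
      then show ?case
        using \<xi>(3) inner by (cases "t \<in> {0..T}") (auto intro!: tendsto_mult)
    qed
    show "AE t in lborel. norm (indicator {0..T} t *\<^sub>R (\<xi> k t * (\<integral>x. L (\<phi> k) t x \<partial>m t)))
        \<le> A * (C * enn2real (W t))" for k
      using W_fin
    proof eventually_elim
      case (elim t)
      show ?case
      proof (cases "t \<in> {0..T}")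
        case True
        then have "0 \<le> A"
          using \<xi>(4)[OF True, of k] by simp
        then show ?thesis
          using True \<xi>(4)[OF True, of k] bound[OF True elim, of k]
          by (simp add: abs_mult mult_mono)
      qed (simp add: W_def)
    qed
  qed measurable
qed

lemma KFP_Borel: "KFP T b a \<in> sets (path_measure T)"
proof -
  obtain D1 where D1: "D1 \<subseteq> C1c T" "countable D1"
    "\<And>\<xi>. \<xi> \<in> C1c T \<Longrightarrow> \<exists>s B. range s \<subseteq> D1 \<and>
       (\<forall>t\<in>{0..T}. (\<lambda>k. (s k t, deriv (s k) t)) \<longlonglongrightarrow> (\<xi> t, deriv \<xi> t)) \<and>
       (\<forall>k. \<forall>t\<in>{0..T}. norm (s k t, deriv (s k) t) \<le> B)"
    by (rule C1c_countably_dense[of T]) blast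
  obtain D2 :: "(real^'n \<Rightarrow> real) set" where D2: "D2 \<subseteq> C2c" "countable D2"
    "\<And>\<phi>. \<phi> \<in> C2c \<Longrightarrow> \<exists>s B N. range s \<subseteq> D2 \<and> (\<forall>x. (\<lambda>k. jet (s k) x) \<longlonglongrightarrow> jet \<phi> x) \<and>
       (\<forall>k x. norm (jet (s k) x) \<le> B) \<and> 0 \<le> N \<and> (\<forall>k x. N < norm x \<longrightarrow> jet (s k) x = 0)"
    by (rule C2c_countably_dense) blast
  \<comment> \<open>The equation on \<open>D1\<close> and \<open>D2\<close> extends to all test
    functions under finite energy, which is a conjunct of both set descriptions compared
    afterwards.\<close>
  have "weak_lhs \<xi> \<phi> \<gamma> = - weak_rhs \<xi> \<phi> \<gamma>"
    if \<gamma>: "\<gamma> \<in> cont_paths T" "energy \<gamma> < \<infinity>"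
      and D: "\<And>\<xi> \<phi>. \<xi> \<in> D1 \<Longrightarrow> \<phi> \<in> D2 \<Longrightarrow> weak_lhs \<xi> \<phi> \<gamma> = - weak_rhs \<xi> \<phi> \<gamma>"
      and \<xi>: "\<xi> \<in> C1c T" and \<phi>: "\<phi> \<in> C2c" for \<gamma> \<xi> \<phi>
  proof -
    obtain s A where s: "range s \<subseteq> D1"
      "\<And>t. t \<in> {0..T} \<Longrightarrow> (\<lambda>k. (s k t, deriv (s k) t)) \<longlonglongrightarrow> (\<xi> t, deriv \<xi> t)"
      "\<And>k t. t \<in> {0..T} \<Longrightarrow> norm (s k t, deriv (s k) t) \<le> A"
      using D1(3)[OF \<xi>] by blast
    obtain r B N where r: "range r \<subseteq> D2" "\<And>x. (\<lambda>k. jet (r k) x) \<longlonglongrightarrow> jet \<phi> x"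
      "\<And>k x. norm (jet (r k) x) \<le> B" "0 \<le> N" "\<And>k x. N < norm x \<Longrightarrow> jet (r k) x = 0"
      using D2(3)[OF \<phi>] by blast
    have s_mem: "s k \<in> D1" "s k \<in> C1c T" and r_mem: "r k \<in> D2" "r k \<in> C2c" for k
      using s(1) r(1) D1(1) D2(1) by auto
    have s_lim: "(\<lambda>k. s k t) \<longlonglongrightarrow> \<xi> t" "(\<lambda>k. deriv (s k) t) \<longlonglongrightarrow> deriv \<xi> t"
      if "t \<in> {0..T}" for t
      using tendsto_fst[OF s(2)[OF that]] tendsto_snd[OF s(2)[OF that]] by simp_all
    have s_bound: "\<bar>s k t\<bar> \<le> A" "\<bar>deriv (s k) t\<bar> \<le> A" if "t \<in> {0..T}" for k t
      using s(3)[OF that, of k] norm_fst_le[of "s k t" "deriv (s k) t"]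
        norm_snd_le[of "deriv (s k) t" "s k t"] by simp_all
    have r_lim: "(\<lambda>k. r k x) \<longlonglongrightarrow> \<phi> x" for x
      using tendsto_fst[OF r(2)[of x]] by (simp add: jet_def)
    have r_bound: "\<bar>r k x\<bar> \<le> B" for k x
      using r(3)[of k x] norm_fst_le[of "r k x" "(grad (r k) x, hessian (r k) x)"]
      by (simp add: jet_def)
    have "(\<lambda>k. weak_lhs (s k) (r k) \<gamma>) \<longlonglongrightarrow> weak_lhs \<xi> \<phi> \<gamma>"
      by (rule tendsto_weak_lhs[where A = A and B = B])
        (use \<gamma> \<xi> \<phi> s_mem r_mem s_lim s_bound r_lim r_bound in auto)
    moreover have "(\<lambda>k. weak_rhs (s k) (r k) \<gamma>) \<longlonglongrightarrow> weak_rhs \<xi> \<phi> \<gamma>"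
      by (rule tendsto_weak_rhs[where A = A and B = B and N = N])
        (use \<gamma> \<xi> \<phi> s_mem r_mem s_lim s_bound r in auto)
    \<comment> \<open>Both approximations run along the same index, so the equation holds at each
      \<open>k\<close> and the sequence of left-hand sides acquires a second limit, which must equal
      the first.\<close>
    then have "(\<lambda>k. weak_lhs (s k) (r k) \<gamma>) \<longlonglongrightarrow> - weak_rhs \<xi> \<phi> \<gamma>"
      unfolding D[OF s_mem(1) r_mem(1)] by (rule tendsto_minus)
    ultimately show ?thesis
      by (rule LIMSEQ_unique)
  qed
  then have "KFP T b a = {\<gamma> \<in> space (path_measure T). energy \<gamma> < \<infinity> \<and>
      (\<forall>\<xi>\<in>D1. \<forall>\<phi>\<in>D2. weak_lhs \<xi> \<phi> \<gamma> = - weak_rhs \<xi> \<phi> \<gamma>)}"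
    unfolding KFP_eq space_path_measure using D1(1) D2(1) by (intro Collect_cong) blast
  also have "\<dots> \<in> sets (path_measure T)"
  proof -
    note [measurable] = measurable_energy
    have "Measurable.pred (path_measure T) (\<lambda>\<gamma>. weak_lhs \<xi> \<phi> \<gamma> = - weak_rhs \<xi> \<phi> \<gamma>)"
      if "\<xi> \<in> D1" "\<phi> \<in> D2" for \<xi> \<phi>
    proof -
      have "\<xi> \<in> C1c T" "\<phi> \<in> C2c"
        using that D1(1) D2(1) by auto
      then show ?thesis
        unfolding pred_def
        by (intro borel_measurable_eq borel_measurable_uminus measurable_weak_lhs measurable_weak_rhs)
    qed
    then have [measurable]: "Measurable.pred (path_measure T)
        (\<lambda>\<gamma>. \<forall>\<xi>\<in>D1. \<forall>\<phi>\<in>D2. weak_lhs \<xi> \<phi> \<gamma> = - weak_rhs \<xi> \<phi> \<gamma>)"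
      by (intro pred_Ball_countable D1(2) D2(2))
    show ?thesis by measurable
  qed
  finally show ?thesis .
qed

end

section \<open>Extension of the coefficients by zero\<close>

lemma KFP_cong:
  assumes "\<And>t x \<mu>. t \<in> {0..T} \<Longrightarrow> b t x \<mu> = b' t x \<mu>" "\<And>t x \<mu>. t \<in> {0..T} \<Longrightarrow> a t x \<mu> = a' t x \<mu>"
  shows "KFP T b a = KFP T b' a'"
proof -
  have "(\<integral>\<^sup>+t\<in>{0..T}. (\<integral>\<^sup>+x. ennreal (norm (b t x (\<mu> t)) / (1 + norm x)
          + norm (a t x (\<mu> t)) / (1 + (norm x)\<^sup>2)) \<partial>the_measure (\<mu> t)) \<partial>lborel) =
      (\<integral>\<^sup>+t\<in>{0..T}. (\<integral>\<^sup>+x. ennreal (norm (b' t x (\<mu> t)) / (1 + norm x)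
          + norm (a' t x (\<mu> t)) / (1 + (norm x)\<^sup>2)) \<partial>the_measure (\<mu> t)) \<partial>lborel)" for \<mu>
    by (intro nn_integral_cong) (auto simp: assms split: split_indicator)
  moreover have "(\<integral>t\<in>{0..T}. \<xi> t * (\<integral>x. KFP_operator b a \<mu> t \<phi> x \<partial>the_measure (\<mu> t)) \<partial>lborel) =
      (\<integral>t\<in>{0..T}. \<xi> t * (\<integral>x. KFP_operator b' a' \<mu> t \<phi> x \<partial>the_measure (\<mu> t)) \<partial>lborel)" for \<xi> \<phi> \<mu>
    unfolding set_lebesgue_integral_def KFP_operator_def
    by (intro Bochner_Integration.integral_cong) (auto simp: assms split: split_indicator)
  ultimately show ?thesis
    unfolding KFP_def by simp
qed

text \<open>The strip over [0,T] is closed, hence Borel in the full product space, so measurability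
  on it passes to the extension by zero.\<close>

lemma measurable_extend_by_zero:
  fixes g :: "real \<Rightarrow> 'a::topological_space \<Rightarrow> 'b::topological_space \<Rightarrow> 'c::real_normed_vector"
  assumes "(\<lambda>(t, x, \<mu>). g t x \<mu>) \<in> borel_measurable (restrict_space borel ({0..T} \<times> UNIV))"
  shows "(\<lambda>(t, x, \<mu>). indicator {0..T} t *\<^sub>R g t x \<mu>) \<in> borel_measurable borel"
proof -
  have "closed ({0..T} \<times> (UNIV :: ('a \<times> 'b) set))"
    by (intro closed_Times) auto
  then have "{0..T} \<times> (UNIV :: ('a \<times> 'b) set) \<in> sets borel"
    by (rule borel_closed)
  then have "(\<lambda>p. indicator ({0..T} \<times> UNIV) p *\<^sub>R (case p of (t, x, \<mu>) \<Rightarrow> g t x \<mu>)) \<in> borel_measurable borel"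
    using assms by (subst (asm) borel_measurable_restrict_space_iff) auto
  then show ?thesis
    by (rule back_subst[of "\<lambda>f. f \<in> borel_measurable borel"])
      (auto simp: fun_eq_iff split: split_indicator)
qed

theorem proposition4p9:
  fixes T :: real
    and b :: "real \<Rightarrow> real^'n \<Rightarrow> (real^'n) prob_measure \<Rightarrow> real^'n"
    and a :: "real \<Rightarrow> real^'n \<Rightarrow> (real^'n) prob_measure \<Rightarrow> real^'n^'n"
  assumes "T > 0"
    and "(\<lambda>(t, x, \<mu>). b t x \<mu>) \<in> borel_measurable (restrict_space borel ({0..T} \<times> UNIV))"
    and "(\<lambda>(t, x, \<mu>). a t x \<mu>) \<in> borel_measurable (restrict_space borel ({0..T} \<times> UNIV))"
    and "\<And>t x \<mu>. t \<in> {0..T} \<Longrightarrow> a t x \<mu> \<in> Sym_plus"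
  shows "KFP T b a \<in> borel_sets_of (compact_open_topology T)"
proof -
  let ?b = "\<lambda>t x \<mu>. indicator {0..T} t *\<^sub>R b t x \<mu>"
  let ?a = "\<lambda>t x \<mu>. indicator {0..T} t *\<^sub>R a t x \<mu>"
  interpret KFP_coefficients T ?b ?a
    using assms(1-3) by unfold_locales (auto intro: measurable_extend_by_zero)
  have "KFP T b a = KFP T ?b ?a"
    by (rule KFP_cong) simp_all
  then show ?thesis
    using KFP_Borel by (simp add: sets_path_measure)
qed

end
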